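(* For all constants $a_0,a_1,a_2>0$ there are constants $c_0,c_1>0$, depending only on $a_0,a_1,a_2$, such that the following holds. Let $N,d\ge1$ and $K\in\{1,\dots,N\}$ be integers with $K$ dividing $N$. Let $\tilde X_1,\dots,\tilde X_N$ be independent random vectors in $\mathbb{R}^d$ with mean $\mu$ and invertible covariance matrix $\Sigma$. Let $X_1,\dots,X_N$ be an adversarially corrupted version of them in which at most $|\mathcal{O}|$ vectors have been modified. Assume that for some $0<\epsilon<1/8$ and constants $0<\varphi_l(\epsilon)<\varphi_u(\epsilon)$, for all $v\in\mathbb{R}^d$ with $\|v\|_2=1$, $$\max\left(W_v\left(\tfrac14-2\epsilon\right)-W_v\left(\tfrac12+2\epsilon\right),\,W_v\left(\tfrac12-2\epsilon\right)-W_v\left(\tfrac34+2\epsilon\right)\right)\le\varphi_u(\epsilon)$$ and $$\min\left(W_v\left(\tfrac14+2\epsilon\right)-W_v\left(\tfrac12-2\epsilon\right),\,W_v\left(\tfrac12+2\epsilon\right)-W_v\left(\tfrac34-2\epsilon\right)\right)\ge\varphi_l(\epsilon).$$ Assume moreover that for all $v\in\mathbb{R}^d$ with $\|v\|_2=1$ and all $r$ with $(2C_0/a_1)\sqrt{(d+1)/K}\le r\le a_0$, $$H_{N,K,v}(r)\le\frac12-a_2r.$$ Assume that $|\mathcal{O}|\le c_0\epsilon K$ and $c_0K\ge\epsilon^{-2}d$. Let $\hat\mu^{SDO}_{MOM,K}\in\mathrm{argmin}_{\nu\in\mathbb{R}^d}SDO_K(\nu)$. Then for all $0<u\le c_0\epsilon^2K$,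 with probability at least $1-2\exp(-u)$, $$\|\Sigma^{-1/2}(\hat\mu^{SDO}_{MOM,K}-\mu)\|_2\le\frac{c_1\varphi_u(\epsilon)}{\varphi_l(\epsilon)}\left(\sqrt{\frac dN}+\sqrt{\frac uN}+\frac{|\mathcal{O}|}{\sqrt{NK}}\right).$$
   Context: $C_0$ is the absolute constant of the following concentration inequality: for all independent random vectors $Y_1,\dots,Y_n$ in $\mathbb{R}^d$, every class $\mathcal F$ of functions from $\mathbb{R}^d$ to $\{0,1\}$ with finite Vapnik-Chervonenkis dimension $VC(\mathcal F)$ and every $u>0$, with probability at least $1-\exp(-u)$, $\sup_{f\in\mathcal F}\frac1n\sum_{i=1}^n (f(Y_i)-\mathbb{E}f(Y_i))\le C_0\left(\sqrt{VC(\mathcal F)/n}+\sqrt{u/n}\right)$. Blocks: $B_1\sqcup\dots\sqcup B_K=\{1,\dots,N\}$ is a fixed partition into $K$ blocks of equal size $N/K$, and $\bar X_k=\frac{1}{|B_k|}\sum_{i\in B_k}X_i$ are the block means of the corrupted data. $$SDO_K(\nu)=\sup_{v\in\mathbb{R}^d}\frac{|\langle\nu,v\rangle-\mathrm{Med}(\langle\bar X_k,v\rangle)|}{\mathrm{Med}(|\langle\bar X_k,v\rangle-\mathrm{Med}(\langle\bar X_k,v\rangle)|)},$$ where the supremum is over nonzero $v$ (with $a/0=+\infty$ for $a>0$ and $0/0=0$) and the medians are over $k\in\{1,\dots,K\}$; $\mathrm{Med}$ is the usual empirical median (the middle order statistic for an odd number of terms, the midpoint of the two middle order statistics for an even number).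 For $\|v\|_2=1$, $r\in\mathbb{R}$ and $p\in(0,1)$ (in terms of the uncorrupted vectors): $$H_v(r)=H_{N,K,v}(r)=\mathbb{P}\left[\frac{1}{\sqrt{N/K}}\sum_{i=1}^{N/K}\langle\Sigma^{-1/2}(\tilde X_i-\mu),v\rangle\ge r\right],\qquad W_v(p)=\max\{r\in\mathbb{R}:H_v(r)\ge p\}.$$ Adversarial corruption: the adversary sees all of $\tilde X_1,\dots,\tilde X_N$ and replaces at most $|\mathcal{O}|$ of them by arbitrary vectors; the set $\mathcal{O}$ of modified indices and the new vectors may depend arbitrarily on all the $\tilde X_i$'s, and $X_i=\tilde X_i$ for $i\notin\mathcal{O}$. Here $|\mathcal{O}|$ is a deterministic upper bound on the number of modified vectors. "With probability at least $p$" means there is an event of probability at least $p$ on which the conclusion holds (for any choice of minimizer). Absolute constants depend on no parameter.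
   Formalization: Added assumption: for each unit v the standardised sums over all blocks B_k have the tail H_v (automatic for i.i.d. vectors); otherwise the claim fails, as H_v sees only the first N/K vectors. The constants are chosen after the type of the sample space, which loses nothing by transfer. *)

theory Defs
  imports "HOL-Probability.Probability" "Jordan_Normal_Form.Matrix"
begin

unbundle no vec_syntax
no_notation inner (infix "\<bullet>" 70)
hide_type (open) Finite_Cartesian_Product.vec
hide_const (open) Finite_Cartesian_Product.vec Finite_Cartesian_Product.mat
  Finite_Cartesian_Product.row Finite_Cartesian_Product.column
  Finite_Cartesian_Product.transpose Finite_Cartesian_Product.vec_nth


text \<open>
  The space \<open>\<real>\<^sup>d\<close> is \<open>carrier_vec d :: real vec set\<close>, not a type: the dimension has to be quantified
  inside the scope of the constants that must not depend on it. Indices run from \<open>0\<close>, so that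
  \<open>{1,\<dots>,n}\<close> becomes \<open>{..<n}\<close>.
\<close>

text \<open>Borel sigma-algebra of \<open>\<real>\<^sup>d\<close>, transported from the product of \<open>d\<close> copies of the real line.\<close>

definition borel_vec :: "nat \<Rightarrow> real vec measure" where
  "borel_vec d =
     vimage_algebra (carrier_vec d) (\<lambda>x. \<lambda>j\<in>{..<d}. x $ j) (PiM {..<d} (\<lambda>_. borel))"

definition norm2 :: "real vec \<Rightarrow> real" where
  "norm2 x = sqrt (x \<bullet> x)"

definition has_mean_cov ::
    "'a measure \<Rightarrow> nat \<Rightarrow> ('a \<Rightarrow> real vec) \<Rightarrow> real vec \<Rightarrow> real mat \<Rightarrow> bool" where
  "has_mean_cov M d Y \<mu> \<Sigma> \<longleftrightarrow>
     Y \<in> M \<rightarrow>\<^sub>M borel_vec d \<and> \<mu> \<in> carrier_vec d \<and> \<Sigma> \<in> carrier_mat d d \<and>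
     (\<forall>j<d. integrable M (\<lambda>\<omega>. (Y \<omega> $ j)\<^sup>2)) \<and>
     (\<forall>j<d. (\<integral>\<omega>. Y \<omega> $ j \<partial>M) = \<mu> $ j) \<and>
     (\<forall>i<d. \<forall>j<d. (\<integral>\<omega>. (Y \<omega> $ i - \<mu> $ i) * (Y \<omega> $ j - \<mu> $ j) \<partial>M) = \<Sigma> $$ (i, j))"

text \<open>\<open>R = \<Sigma>\<^sup>-\<^sup>1\<^sup>/\<^sup>2\<close>: the (unique) symmetric positive semidefinite matrix with \<open>R\<^sup>2 = \<Sigma>\<^sup>-\<^sup>1\<close>.\<close>

definition is_inv_sqrt :: "nat \<Rightarrow> real mat \<Rightarrow> real mat \<Rightarrow> bool" where
  "is_inv_sqrt d \<Sigma> R \<longleftrightarrow>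
     R \<in> carrier_mat d d \<and> transpose_mat R = R \<and>
     (\<forall>x\<in>carrier_vec d. 0 \<le> x \<bullet> (R *\<^sub>v x)) \<and>
     (R * R) * \<Sigma> = 1\<^sub>m d \<and> \<Sigma> * (R * R) = 1\<^sub>m d"


definition shatters :: "(real vec \<Rightarrow> real) set \<Rightarrow> real vec set \<Rightarrow> bool" where
  "shatters F S \<longleftrightarrow> (\<forall>T\<subseteq>S. \<exists>f\<in>F. \<forall>x\<in>S. f x = indicator T x)"

definition shattered_cards :: "nat \<Rightarrow> (real vec \<Rightarrow> real) set \<Rightarrow> nat set" where
  "shattered_cards d F = {card S |S. S \<subseteq> carrier_vec d \<and> finite S \<and> shatters F S}"

definition VC :: "nat \<Rightarrow> (real vec \<Rightarrow> real) set \<Rightarrow> nat" where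
  "VC d F = Sup (shattered_cards d F)"

text \<open>
  Nonempty classes of \<open>{0,1}\<close>-valued Borel functions on \<open>\<real>\<^sup>d\<close>. The last conjunct (a countable
  subclass is pointwise sequentially dense) is the usual convention under which suprema over an
  uncountable class are measurable; without it the inequality below fails under the continuum
  hypothesis, e.g. for the initial segments of a well-order of type \<open>\<omega>\<^sub>1\<close> of the real line, a
  class of countable sets with VC dimension 1.
\<close>

definition binary_class :: "nat \<Rightarrow> (real vec \<Rightarrow> real) set \<Rightarrow> bool" where
  "binary_class d F \<longleftrightarrow>
     F \<noteq> {} \<and>
     (\<forall>f\<in>F. f \<in> borel_measurable (borel_vec d) \<and> f ` carrier_vec d \<subseteq> {0, 1}) \<and>
     (\<exists>G\<subseteq>F. countable G \<and>
        (\<forall>f\<in>F. \<exists>g. (\<forall>m::nat. g m \<in> G) \<and> (\<forall>x\<in>carrier_vec d. (\<lambda>m. g m x) \<longlonglongrightarrow> f x)))"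

text \<open>
  \<open>C\<^sub>0\<close> is admissible in the Vapnik-Chervonenkis concentration inequality. Independent vectors
  \<open>Y\<^sub>i\<close> with laws \<open>Q i\<close> are taken to be the coordinates of the product space; this loses nothing,
  since the inequality only depends on the joint law, and it keeps the definition free of a type
  variable for the sample space.
\<close>

definition VC_constant :: "real \<Rightarrow> bool" where
  "VC_constant C\<^sub>0 \<longleftrightarrow>
     0 < C\<^sub>0 \<and>
     (\<forall>d n Q F u.
        1 \<le> d \<longrightarrow> 1 \<le> n \<longrightarrow>
        (\<forall>i<n. prob_space (Q i) \<and> sets (Q i) = sets (borel_vec d)) \<longrightarrow>
        binary_class d F \<longrightarrow> finite (shattered_cards d F) \<longrightarrow> 0 < u \<longrightarrow>
        (\<exists>E\<in>sets (PiM {..<n} Q).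
           measure (PiM {..<n} Q) E \<ge> 1 - exp (- u) \<and>
           (\<forall>y\<in>E. (SUP f\<in>F. (1 / real n) * (\<Sum>i<n. f (y i) - (\<integral>x. f x \<partial>Q i)))
                    \<le> C\<^sub>0 * (sqrt (real (VC d F) / real n) + sqrt (u / real n)))))"


definition equal_blocks :: "nat \<Rightarrow> nat \<Rightarrow> (nat \<Rightarrow> nat set) \<Rightarrow> bool" where
  "equal_blocks N K B \<longleftrightarrow>
     disjoint_family_on B {..<K} \<and> (\<Union>k<K. B k) = {..<N} \<and> (\<forall>k<K. card (B k) = N div K)"

definition block_mean :: "nat \<Rightarrow> (nat \<Rightarrow> nat set) \<Rightarrow> (nat \<Rightarrow> real vec) \<Rightarrow> nat \<Rightarrow> real vec" where
  "block_mean d B x k = vec d (\<lambda>j. (\<Sum>i\<in>B k. x i $ j) / real (card (B k)))"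

definition Med :: "nat \<Rightarrow> (nat \<Rightarrow> real) \<Rightarrow> real" where
  "Med K z = (let s = sort (map z [0..<K]) in
     if odd K then s ! (K div 2) else (s ! (K div 2 - 1) + s ! (K div 2)) / 2)"

text \<open>
  Division in \<^typ>\<open>ereal\<close> satisfies \<open>a / 0 = \<infinity>\<close> for \<open>a > 0\<close> and \<open>0 / 0 = 0\<close>, the convention
  required here.
\<close>

definition SDO ::
    "nat \<Rightarrow> nat \<Rightarrow> (nat \<Rightarrow> nat set) \<Rightarrow> (nat \<Rightarrow> real vec) \<Rightarrow> real vec \<Rightarrow> ereal" where
  "SDO d K B x \<nu> =
     (SUP v\<in>carrier_vec d - {0\<^sub>v d}.
        let m = Med K (\<lambda>k. block_mean d B x k \<bullet> v)
        in ereal \<bar>\<nu> \<bullet> v - m\<bar> / ereal (Med K (\<lambda>k. \<bar>block_mean d B x k \<bullet> v - m\<bar>)))"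

definition std_tail ::
    "'a measure \<Rightarrow> real mat \<Rightarrow> real vec \<Rightarrow> (nat \<Rightarrow> 'a \<Rightarrow> real vec) \<Rightarrow> nat set \<Rightarrow> real vec \<Rightarrow> real \<Rightarrow> real"
  where
  "std_tail M R \<mu> Y I v r =
     measure M {\<omega> \<in> space M. (1 / sqrt (real (card I))) * (\<Sum>i\<in>I. (R *\<^sub>v (Y i \<omega> - \<mu>)) \<bullet> v) \<ge> r}"

definition H_tail ::
    "'a measure \<Rightarrow> nat \<Rightarrow> nat \<Rightarrow> real mat \<Rightarrow> real vec \<Rightarrow> (nat \<Rightarrow> 'a \<Rightarrow> real vec) \<Rightarrow> real vec \<Rightarrow> real \<Rightarrow> real"
  where
  "H_tail M N K R \<mu> Y v r = std_tail M R \<mu> Y {..<N div K} v r"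

definition W_quantile ::
    "'a measure \<Rightarrow> nat \<Rightarrow> nat \<Rightarrow> real mat \<Rightarrow> real vec \<Rightarrow> (nat \<Rightarrow> 'a \<Rightarrow> real vec) \<Rightarrow> real vec \<Rightarrow> real \<Rightarrow> real"
  where
  "W_quantile M N K R \<mu> Y v p = (GREATEST r. H_tail M N K R \<mu> Y v r \<ge> p)"

text \<open>
  A single function \<open>H\<^sub>v\<close>, defined through the first \<open>N/K\<close> vectors, describes every block only if
  the standardised block sums have the same distribution. This is automatic for identically
  distributed vectors, and is all that is required of the blocks here.
\<close>

definition common_block_law ::
    "'a measure \<Rightarrow> nat \<Rightarrow> nat \<Rightarrow> nat \<Rightarrow> (nat \<Rightarrow> nat set) \<Rightarrow> real mat \<Rightarrow> real vec \<Rightarrow>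
     (nat \<Rightarrow> 'a \<Rightarrow> real vec) \<Rightarrow> bool" where
  "common_block_law M N d K B R \<mu> Y \<longleftrightarrow>
     (\<forall>k<K. \<forall>v\<in>carrier_vec d. norm2 v = 1 \<longrightarrow>
        (\<forall>r. std_tail M R \<mu> Y (B k) v r = H_tail M N K R \<mu> Y v r))"

text \<open>
  Neither the set of modified indices nor the new vectors need be measurable: they are arbitrary
  functions of the sample point.
\<close>

definition corrupted ::
    "'a measure \<Rightarrow> nat \<Rightarrow> nat \<Rightarrow> nat \<Rightarrow> (nat \<Rightarrow> 'a \<Rightarrow> real vec) \<Rightarrow> (nat \<Rightarrow> 'a \<Rightarrow> real vec) \<Rightarrow> bool" where
  "corrupted M N d m Y X \<longleftrightarrow>
     (\<forall>\<omega>\<in>space M. (\<forall>i<N. X i \<omega> \<in> carrier_vec d) \<and> card {i. i < N \<and> X i \<omega> \<noteq> Y i \<omega>} \<le> m)"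

end

theory Submission
  imports Defs "Jordan_Normal_Form.Determinant"
begin

text \<open>
  In the coordinates given by \<open>R = \<Sigma>\<^sup>-\<^sup>1\<^sup>/\<^sup>2\<close> the outlyingness is a supremum over unit directions \<open>e\<close> of
  \<open>\<bar>\<langle>z, e\<rangle> - Med y\<bar> / MAD y\<close>, where \<open>z = sqrt (N/K) R (\<nu> - \<mu>)\<close> and \<open>y k\<close> is the projection on \<open>e\<close> of
  the \<open>k\<close>-th standardised block sum (\<open>SDO_ratio\<close>). So everything reduces to controlling the median
  and the median absolute deviation of the \<open>K\<close> numbers \<open>y k\<close>, uniformly in \<open>e\<close>.

  This uniformity is where the Vapnik-Chervonenkis inequality enters. The block sums are \<open>K\<close>
  independent vectors, and the class of closed half-spaces of \<open>\<real>\<^sup>d\<close> has dimension at most \<open>d + 1\<close>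
  (\<open>VC_halfspaces\<close>, by Radon's argument). Hence, on a single event of probability at least
  \<open>1 - exp (- u)\<close>, the proportion of blocks with \<open>y k \<ge> r\<close> is within
  \<open>\<delta> = C\<^sub>0 (sqrt ((d+1)/K) + sqrt (u/K)) + m/K\<close> of the tail \<open>H\<^sub>e r\<close>, for all \<open>e\<close> and \<open>r\<close> at once. The
  term \<open>m/K\<close> pays for the corruption, because \<open>m\<close> modified vectors spoil at most \<open>m\<close> blocks
  (\<open>corrupted_empirical_tail\<close>). The smallness of \<open>c\<^sub>0\<close> makes \<open>\<delta> \<le> \<epsilon>\<close>.

  On that event the rest is deterministic. Shifting levels by \<open>2\<epsilon>\<close> absorbs the error \<open>\<delta>\<close>, so the
  empirical median lies between two quantiles of \<open>H\<^sub>e\<close>, and the hypotheses on \<open>W\<close> give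
  \<open>\<phi>\<^sub>l \<le> MAD y \<le> \<phi>\<^sub>u\<close> (\<open>quantile_bounds\<close>). The linear decay of \<open>H\<^sub>e\<close> at the point
  \<open>\<rho> = (2C\<^sub>0/a\<^sub>1) sqrt ((d+1)/K) + (2/a\<^sub>2) \<delta>\<close> gives \<open>H\<^sub>e \<rho> + \<delta> < 1/2\<close> and therefore \<open>\<bar>Med y\<bar> \<le> \<rho>\<close>
  (\<open>abs_Med_le\<close>). At \<open>\<nu> = \<mu>\<close> the outlyingness is then at most \<open>\<rho>/\<phi>\<^sub>l\<close>, so it is at most that at a
  minimiser; reading it there in the direction of \<open>z\<close> gives \<open>\<parallel>z\<parallel> \<le> \<rho> + \<rho> \<phi>\<^sub>u/\<phi>\<^sub>l\<close>
  (\<open>SDO_argmin_bound\<close>), and \<open>\<rho>\<close> has the announced order.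
\<close>

section \<open>Empirical medians\<close>

text \<open>
  With strictly less than half of the sample below \<open>x\<close>, the middle order statistics are at least \<open>x\<close>
  for either parity of \<open>K\<close>. Exactly half would let the lower of the two averaged ones, for even \<open>K\<close>,
  drop below \<open>x\<close>.
\<close>

lemma le_Med:
  assumes "2 * card {k. k < K \<and> z k < x} < K"
  shows "x \<le> Med K z"
proof -
  define s where "s = sort (map z [0..<K])"
  have s: "sorted s" "length s = K" by (simp_all add: s_def)
  have key: "x \<le> s ! i" if i: "i < K" "K \<le> 2 * i + 2" for i
  proof (rule ccontr)
    assume "\<not> x \<le> s ! i"
    then have lt: "s ! i < x" by simp
    have "{..i} \<subseteq> {j. j < length s \<and> s ! j < x}"
    proof
      fix j assume "j \<in> {..i}"
      then have "s ! j \<le> s ! i" "j < length s" using s i by (auto intro: sorted_nth_mono)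
      with lt show "j \<in> {j. j < length s \<and> s ! j < x}" by simp
    qed
    then have "card {..i} \<le> card {j. j < length s \<and> s ! j < x}"
      by (intro card_mono) auto
    also have "\<dots> = length (filter (\<lambda>t. t < x) s)"
      by (simp add: length_filter_conv_card)
    also have "\<dots> = length (filter (\<lambda>t. t < x) (map z [0..<K]))"
      unfolding s_def by (metis mset_filter mset_sort size_mset)
    also have "\<dots> = card {k. k < K \<and> z k < x}"
      by (auto simp: length_filter_conv_card intro!: arg_cong[where f = card])
    finally have "2 * (i + 1) < K" using assms by simp
    with i show False by simp
  qed
  have K: "0 < K" using assms by simp
  show ?thesis
  proof (cases "odd K")
    case True
    then have "x \<le> s ! (K div 2)" using K by (intro key) (auto elim!: oddE)
    with True show ?thesis by (simp add: Med_def s_def Let_def)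
  next
    case False
    then have "x \<le> s ! (K div 2)" "x \<le> s ! (K div 2 - 1)"
      using K by (auto intro!: key elim!: evenE)
    with False show ?thesis by (simp add: Med_def s_def[symmetric] Let_def)
  qed
qed

lemma sort_map_mono:
  assumes "mono f"
  shows "sort (map f xs) = map f (sort xs)"
  using assms by (intro properties_for_sort) (auto simp: sorted_map monoD intro: sorted_wrt_mono_rel[of _ "(\<le>)"])

lemma Med_le:
  assumes "2 * card {k. k < K \<and> x < z k} < K"
  shows "Med K z \<le> x"
proof -
  define s where "s = sort (map z [0..<K])"
  have s: "sorted s" "length s = K" by (simp_all add: s_def)
  have key: "s ! i \<le> x" if i: "i < K" "2 * i \<le> K" for i
  proof (rule ccontr)
    assume "\<not> s ! i \<le> x"
    then have lt: "x < s ! i" by simp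
    have "{i..<K} \<subseteq> {j. j < length s \<and> x < s ! j}"
    proof
      fix j assume "j \<in> {i..<K}"
      then have "s ! i \<le> s ! j" "j < length s" using s i by (auto intro: sorted_nth_mono)
      with lt show "j \<in> {j. j < length s \<and> x < s ! j}" by simp
    qed
    then have "card {i..<K} \<le> card {j. j < length s \<and> x < s ! j}"
      by (intro card_mono) auto
    also have "\<dots> = length (filter (\<lambda>t. x < t) s)"
      by (simp add: length_filter_conv_card)
    also have "\<dots> = length (filter (\<lambda>t. x < t) (map z [0..<K]))"
      unfolding s_def by (metis mset_filter mset_sort size_mset)
    also have "\<dots> = card {k. k < K \<and> x < z k}"
      by (auto simp: length_filter_conv_card intro!: arg_cong[where f = card])
    finally have "2 * (K - i) < K" using assms by simp
    with i show False by simp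
  qed
  have K: "0 < K" using assms by simp
  show ?thesis
  proof (cases "odd K")
    case True
    then have "s ! (K div 2) \<le> x" using K by (intro key) (auto elim!: oddE)
    with True show ?thesis by (simp add: Med_def s_def Let_def)
  next
    case False
    then have "s ! (K div 2) \<le> x" "s ! (K div 2 - 1) \<le> x"
      using K by (auto intro!: key elim!: evenE)
    with False show ?thesis by (simp add: Med_def s_def[symmetric] Let_def)
  qed
qed

lemma Med_affine:
  fixes c s :: real
  assumes "0 \<le> s" "0 < K"
  shows "Med K (\<lambda>k. c + s * z k) = c + s * Med K z"
proof -
  have m: "mono (\<lambda>t. c + s * t)"
    using assms by (intro monoI) (simp add: mult_left_mono)
  have "map (\<lambda>k. c + s * z k) [0..<K] = map (\<lambda>t. c + s * t) (map z [0..<K])" by simp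
  then have "sort (map (\<lambda>k. c + s * z k) [0..<K]) = map (\<lambda>t. c + s * t) (sort (map z [0..<K]))"
    using sort_map_mono[OF m] by metis
  then show ?thesis using assms
    by (simp add: Med_def Let_def add_divide_distrib algebra_simps)
qed

section \<open>Quantiles of a tail function\<close>

text \<open>
  The maximum in the definition of a quantile is attained because \<open>r \<mapsto> P(S \<ge> r)\<close> is left-continuous.
  Right-continuity of the distribution function of \<open>- S\<close> says exactly this, and its limits at
  \<open>\<plusminus>\<infinity>\<close> show that the set of admissible \<open>r\<close> is nonempty and bounded above.
\<close>

lemma (in prob_space) tail_GREATEST:
  fixes S :: "'a \<Rightarrow> real"
  assumes [measurable]: "S \<in> borel_measurable M" and p: "0 < p" "p < 1"
  defines "h \<equiv> \<lambda>r. prob {\<omega> \<in> space M. S \<omega> \<ge> r}"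
  defines "w \<equiv> (GREATEST r. h r \<ge> p)"
  shows "h w \<ge> p" and "\<And>r. w < r \<Longrightarrow> h r < p"
proof -
  interpret D: real_distribution "distr M borel (\<lambda>\<omega>. - S \<omega>)" by simp
  let ?F = "cdf (distr M borel (\<lambda>\<omega>. - S \<omega>))"
  have hF: "h r = ?F (- r)" for r
    unfolding h_def cdf_def2 by (subst measure_distr) (auto intro!: arg_cong[where f = prob])
  let ?A = "{r. h r \<ge> p}"
  have anti: "h t \<le> h r" if "r \<le> t" for r t
    unfolding hF using that by (intro D.cdf_nondecreasing) simp
  have "eventually (\<lambda>x. p < ?F x) at_top"
    using D.cdf_lim_at_top_prob p(2) by (rule order_tendstoD)
  then obtain x where "p < ?F x" by (auto simp: eventually_at_top_linorder)
  then have ne: "- x \<in> ?A" by (simp add: hF)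
  have "eventually (\<lambda>x. ?F x < p) at_bot"
    using D.cdf_lim_at_bot p(1) by (rule order_tendstoD)
  then obtain y where y: "?F y < p" by (auto simp: eventually_at_bot_linorder)
  have bd: "r \<le> - y" if "r \<in> ?A" for r
  proof (rule ccontr)
    assume "\<not> r \<le> - y"
    then have "h r \<le> h (- y)" by (intro anti) simp
    with y that show False by (simp add: hF)
  qed
  have bdd: "bdd_above ?A" by (rule bdd_aboveI[OF bd])
  have sup: "p \<le> h (Sup ?A)"
  proof -
    have c: "(?F \<longlongrightarrow> ?F (- Sup ?A)) (at_right (- Sup ?A))"
      using D.cdf_is_right_cont by (simp add: continuous_within)
    have "\<forall>\<^sub>F t in at_right (- Sup ?A). p \<le> ?F t"
      unfolding eventually_at_right_field
    proof (intro exI[of _ "- Sup ?A + 1"] conjI allI impI)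
      fix t assume "- Sup ?A < t"
      then have "- t < Sup ?A" by simp
      then obtain r where "r \<in> ?A" "- t < r" using less_cSupE[of "- t" ?A] ne by blast
      then have "p \<le> h (- t)" using anti[of "- t" r] by simp
      then show "p \<le> ?F t" by (simp add: hF)
    qed simp
    then have "p \<le> ?F (- Sup ?A)" by (rule tendsto_lowerbound[OF c]) simp
    then show ?thesis unfolding hF[of "Sup ?A"] .
  qed
  have w: "w = Sup ?A" unfolding w_def
    using sup by (intro Greatest_equality) (auto intro: cSup_upper bdd)
  show "h w \<ge> p" using sup w by simp
  show "h r < p" if "w < r" for r
    using cSup_upper[OF _ bdd, of r] that w by force
qed

section \<open>Medians of a sample whose empirical tail is known\<close>

text \<open>
  On a finite sample a strict inequality can be replaced by a weak one at a shifted threshold, so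
  closed half-spaces control the counts for open ones as well.
\<close>

lemma finite_gap_above:
  fixes y :: "nat \<Rightarrow> real"
  obtains r' where "r < r'" "\<And>k. k < K \<Longrightarrow> r < y k \<Longrightarrow> r' \<le> y k"
proof -
  let ?A = "insert (r + 1) {y k |k. k < K \<and> r < y k}"
  have fin: "finite ?A" by simp
  then have "Min ?A \<in> ?A" by (intro Min_in) auto
  then have "r < Min ?A" by auto
  moreover have "Min ?A \<le> y k" if "k < K" "r < y k" for k
    using that fin by (intro Min_le) auto
  ultimately show thesis using that by blast
qed

lemma finite_gap_below:
  fixes y :: "nat \<Rightarrow> real"
  obtains r' where "r' < r" "\<And>k. k < K \<Longrightarrow> y k < r \<Longrightarrow> y k \<le> r'"
proof -
  obtain r' where r': "- r < r'" "\<And>k. k < K \<Longrightarrow> - r < - y k \<Longrightarrow> r' \<le> - y k"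
    using finite_gap_above[of "- r" K "\<lambda>k. - y k"] by blast
  show thesis
  proof (rule that[of "- r'"])
    show "- r' < r" using r'(1) by simp
    show "y k \<le> - r'" if "k < K" "y k < r" for k using r'(2)[of k] that by simp
  qed
qed

text \<open>
  Both counts stay within \<open>\<delta> K\<close> of what the tail \<open>h r = P(S \<ge> r)\<close> predicts. Only upper bounds on counts
  are stated: a median is bounded from either side by showing that few points lie beyond.
\<close>

locale empirical_tail =
  fixes K :: nat and y :: "nat \<Rightarrow> real" and h :: "real \<Rightarrow> real" and \<delta> :: real
  assumes K_pos: "0 < K"
    and count_ge: "real (card {k. k < K \<and> r \<le> y k}) \<le> (h r + \<delta>) * real K"
    and count_less: "real (card {k. k < K \<and> y k < r}) \<le> (1 - h r + \<delta>) * real K"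
begin

text \<open>
  The median exceeds \<open>\<rho>\<close> only if at least half of the sample does. The lower bound is the same statement for
  the reflected sample \<open>- y\<close>, whose tail is \<open>h'\<close>.
\<close>

lemma abs_Med_le:
  assumes h: "h \<rho> + \<delta> < 1/2"
    and h': "\<And>r. real (card {k. k < K \<and> r \<le> - y k}) \<le> (h' r + \<delta>) * real K" "h' \<rho> + \<delta> < 1/2"
  shows "\<bar>Med K y\<bar> \<le> \<rho>"
proof -
  have half: "2 * card A < K" if "real (card A) \<le> q * real K" "q < 1/2" for q and A :: "nat set"
  proof -
    have "q * real K < 1/2 * real K" using that K_pos by (intro mult_strict_right_mono) auto
    with that(1) show ?thesis by simp
  qed
  have "card {k. k < K \<and> \<rho> < y k} \<le> card {k. k < K \<and> \<rho> \<le> y k}"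
    by (intro card_mono) auto
  then have "Med K y \<le> \<rho>"
    using half[OF count_ge h] by (intro Med_le) simp
  moreover have "card {k. k < K \<and> y k < - \<rho>} \<le> card {k. k < K \<and> \<rho> \<le> - y k}"
    by (intro card_mono) auto
  then have "- \<rho> \<le> Med K y"
    using half[OF h'(1)[of \<rho>] h'(2)] by (intro le_Med) simp
  ultimately show ?thesis by simp
qed

text \<open>
  Below, \<open>w p\<close> is the largest point at which \<open>h\<close> is at least \<open>p\<close>.
\<close>

context
  fixes w :: "real \<Rightarrow> real"
  assumes w_le: "\<And>p. 0 < p \<Longrightarrow> p < 1 \<Longrightarrow> p \<le> h (w p)"
    and w_gt: "\<And>p r. 0 < p \<Longrightarrow> p < 1 \<Longrightarrow> w p < r \<Longrightarrow> h r < p"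
begin

lemma count_below_quantile:
  assumes p: "0 < p" "p < 1" and t: "t \<le> w p"
  shows "real (card {k. k < K \<and> y k < t}) \<le> (1 - p + \<delta>) * real K"
proof -
  have "card {k. k < K \<and> y k < t} \<le> card {k. k < K \<and> y k < w p}"
    using t by (intro card_mono) auto
  then have "real (card {k. k < K \<and> y k < t}) \<le> (1 - h (w p) + \<delta>) * real K"
    using count_less[of "w p"] by linarith
  also have "\<dots> \<le> (1 - p + \<delta>) * real K"
    using w_le[OF p] by (intro mult_right_mono) auto
  finally show ?thesis .
qed

lemma count_above_quantile:
  assumes p: "0 < p" "p < 1" and t: "w p \<le> t"
  shows "real (card {k. k < K \<and> t < y k}) \<le> (p + \<delta>) * real K"
proof -
  obtain r where r: "t < r" "\<And>k. k < K \<Longrightarrow> t < y k \<Longrightarrow> r \<le> y k"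
    using finite_gap_above[of t K y] by blast
  have "card {k. k < K \<and> t < y k} \<le> card {k. k < K \<and> r \<le> y k}"
    using r by (intro card_mono) auto
  then have "real (card {k. k < K \<and> t < y k}) \<le> (h r + \<delta>) * real K"
    using count_ge[of r] by linarith
  also have "\<dots> \<le> (p + \<delta>) * real K"
    using w_gt[OF p, of r] r(1) t by (intro mult_right_mono) auto
  finally show ?thesis .
qed

text \<open>
  Since \<open>\<delta> < 2\<epsilon>\<close>, the median lies in \<open>[w (1/2 + 2\<epsilon>), w (1/2 - 2\<epsilon>)]\<close>. Moving from there to the right by
  less than \<open>\<phi>\<^sub>l\<close> stays below \<open>w (1/4 + 2\<epsilon>)\<close>, and moving by \<open>\<phi>\<^sub>u\<close> reaches
  \<open>w (1/4 - 2\<epsilon>)\<close>; the same holds on the left with \<open>w (3/4 - 2\<epsilon>)\<close> and \<open>w (3/4 + 2\<epsilon>)\<close>. So an interval of radius \<open>\<phi>\<^sub>l\<close>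
  about the median misses at least a quarter of the sample on each side, and one of radius \<open>\<phi>\<^sub>u\<close>
  misses at most a quarter on each side, with a margin of \<open>2\<epsilon> - \<delta>\<close> each time.
\<close>

lemma quantile_bounds:
  assumes e: "0 < \<epsilon>" "\<epsilon> < 1/8" and d: "\<delta> < 2 * \<epsilon>"
    and up: "w (1/4 - 2*\<epsilon>) - w (1/2 + 2*\<epsilon>) \<le> \<phi>\<^sub>u" "w (1/2 - 2*\<epsilon>) - w (3/4 + 2*\<epsilon>) \<le> \<phi>\<^sub>u"
    and lo: "\<phi>\<^sub>l \<le> w (1/4 + 2*\<epsilon>) - w (1/2 - 2*\<epsilon>)" "\<phi>\<^sub>l \<le> w (1/2 + 2*\<epsilon>) - w (3/4 - 2*\<epsilon>)"
    and pos: "0 < \<phi>\<^sub>l"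
  shows "\<phi>\<^sub>l \<le> Med K (\<lambda>k. \<bar>y k - Med K y\<bar>)" and "Med K (\<lambda>k. \<bar>y k - Med K y\<bar>) \<le> \<phi>\<^sub>u"
proof -
  let ?m = "Med K y"
  have scale: "a * real K < b * real K" if "a < b" for a b :: real
    using that K_pos by (intro mult_strict_right_mono) auto
  have "real (card {k. k < K \<and> y k < w (1/2 + 2*\<epsilon>)}) \<le> (1 - (1/2 + 2*\<epsilon>) + \<delta>) * real K"
    using e by (intro count_below_quantile) auto
  also have "\<dots> < 1/2 * real K" using d by (intro scale) simp
  finally have m1: "w (1/2 + 2*\<epsilon>) \<le> ?m" by (intro le_Med) simp
  have "real (card {k. k < K \<and> w (1/2 - 2*\<epsilon>) < y k}) \<le> (1/2 - 2*\<epsilon> + \<delta>) * real K"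
    using e by (intro count_above_quantile) auto
  also have "\<dots> < 1/2 * real K" using d by (intro scale) simp
  finally have m2: "?m \<le> w (1/2 - 2*\<epsilon>)" by (intro Med_le) simp

  let ?A = "{k. k < K \<and> y k < ?m + \<phi>\<^sub>l}" and ?B = "{k. k < K \<and> ?m - \<phi>\<^sub>l < y k}"
  have A: "real (card ?A) \<le> (1 - (1/4 + 2*\<epsilon>) + \<delta>) * real K"
    using e m2 lo by (intro count_below_quantile) auto
  have B: "real (card ?B) \<le> (3/4 - 2*\<epsilon> + \<delta>) * real K"
    using e m1 lo by (intro count_above_quantile) auto
  have un: "?A \<union> ?B = {..<K}" using pos by auto
  have int: "{k. k < K \<and> \<bar>y k - ?m\<bar> < \<phi>\<^sub>l} = ?A \<inter> ?B" by auto
  have "card ?A + card ?B = K + card (?A \<inter> ?B)"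
    using card_Un_Int[of ?A ?B] un by simp
  then have "real (card (?A \<inter> ?B)) = real (card ?A) + real (card ?B) - real K"
    by linarith
  also have "\<dots> \<le> (1/2 - 4 * \<epsilon> + 2 * \<delta>) * real K" using A B by (simp add: algebra_simps)
  also have "\<dots> < 1/2 * real K" using d by (intro scale) simp
  finally show "\<phi>\<^sub>l \<le> Med K (\<lambda>k. \<bar>y k - ?m\<bar>)"
    by (intro le_Med) (simp add: int)

  have U: "real (card {k. k < K \<and> ?m + \<phi>\<^sub>u < y k}) \<le> (1/4 - 2*\<epsilon> + \<delta>) * real K"
    using e m1 up by (intro count_above_quantile) auto
  have L: "real (card {k. k < K \<and> y k < ?m - \<phi>\<^sub>u}) \<le> (1 - (3/4 + 2*\<epsilon>) + \<delta>) * real K"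
    using e m2 up by (intro count_below_quantile) auto
  have "card {k. k < K \<and> \<phi>\<^sub>u < \<bar>y k - ?m\<bar>}
      \<le> card ({k. k < K \<and> ?m + \<phi>\<^sub>u < y k} \<union> {k. k < K \<and> y k < ?m - \<phi>\<^sub>u})"
    by (intro card_mono) auto
  also have "\<dots> \<le> card {k. k < K \<and> ?m + \<phi>\<^sub>u < y k} + card {k. k < K \<and> y k < ?m - \<phi>\<^sub>u}"
    by (rule card_Un_le)
  finally have "real (card {k. k < K \<and> \<phi>\<^sub>u < \<bar>y k - ?m\<bar>}) \<le> (1/2 - 4 * \<epsilon> + 2 * \<delta>) * real K"
    using U L by (simp add: algebra_simps)
  also have "\<dots> < 1/2 * real K" using d by (intro scale) simp
  finally show "Med K (\<lambda>k. \<bar>y k - ?m\<bar>) \<le> \<phi>\<^sub>u"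
    by (intro Med_le) simp
qed

end
end

section \<open>Half-spaces as a Vapnik-Chervonenkis class\<close>

definition halfspaces :: "nat \<Rightarrow> (real vec \<Rightarrow> real) set" where
  "halfspaces d = {\<lambda>x. if r \<le> x \<bullet> v then 1 else 0 | v r. v \<in> carrier_vec d}"

lemma mult_mat_vec_nth:
  assumes "A \<in> carrier_mat n n" "w \<in> carrier_vec n" "j < n"
  shows "(A *\<^sub>v w) $ j = (\<Sum>i<n. A $$ (j, i) * w $ i)"
  using assms by (simp add: scalar_prod_def lessThan_atLeast0)

text \<open>
  Any \<open>d + 2\<close> points of \<open>\<real>\<^sup>d\<close> are affinely dependent. The coefficients form a kernel vector of the
  square matrix whose columns are the points with an appended \<open>1\<close>; repeating the row of ones makes
  the matrix square with determinant zero.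
\<close>

lemma affine_dependence:
  fixes x :: "nat \<Rightarrow> real vec"
  assumes "\<And>i. i < d + 2 \<Longrightarrow> x i \<in> carrier_vec d"
  obtains l :: "nat \<Rightarrow> real" where "\<exists>i<d+2. l i \<noteq> 0" "(\<Sum>i<d+2. l i) = 0"
    "\<And>v r. v \<in> carrier_vec d \<Longrightarrow> (\<Sum>i<d+2. l i * (x i \<bullet> v - r)) = 0"
proof -
  define A where "A = mat (d+2) (d+2) (\<lambda>(j, i). if j < d then x i $ j else 1)"
  have A: "A \<in> carrier_mat (d+2) (d+2)" by (simp add: A_def)
  have "row A d = row A (d+1)" by (rule eq_vecI) (simp_all add: A_def)
  then have "det A = 0" using det_identical_rows[OF A, of d "d+1"] by simp
  then obtain w where w: "w \<in> carrier_vec (d+2)" "w \<noteq> 0\<^sub>v (d+2)" "A *\<^sub>v w = 0\<^sub>v (d+2)"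
    using det_0_iff_vec_prod_zero[OF A] by blast
  have rows: "(\<Sum>i<d+2. A $$ (j, i) * w $ i) = 0" if "j < d+2" for j
  proof -
    have "(A *\<^sub>v w) $ j = 0" using w(3) that by simp
    then show ?thesis using mult_mat_vec_nth[OF A w(1) that] by simp
  qed
  have s0: "(\<Sum>i<d+2. w $ i) = 0" using rows[of d] by (simp add: A_def)
  have sj: "(\<Sum>i<d+2. x i $ j * w $ i) = 0" if "j < d" for j
    using rows[of j] that by (simp add: A_def)
  show thesis
  proof (rule that[of "\<lambda>i. w $ i"])
    show "\<exists>i<d+2. w $ i \<noteq> 0"
      using w(1,2) by (metis carrier_vecD eq_vecI index_zero_vec)
    show "(\<Sum>i<d+2. w $ i) = 0" by (rule s0)
    fix v :: "real vec" and r assume v: "v \<in> carrier_vec d"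
    have "w $ i * (x i \<bullet> v - r) = (\<Sum>j<d. v $ j * (x i $ j * w $ i)) - r * w $ i" for i
      using v by (simp add: scalar_prod_def lessThan_atLeast0 right_diff_distrib sum_distrib_left mult_ac)
    then have "(\<Sum>i<d+2. w $ i * (x i \<bullet> v - r))
        = (\<Sum>i<d+2. \<Sum>j<d. v $ j * (x i $ j * w $ i)) - r * (\<Sum>i<d+2. w $ i)"
      by (simp only: sum_subtractf sum_distrib_left)
    also have "(\<Sum>i<d+2. \<Sum>j<d. v $ j * (x i $ j * w $ i)) = (\<Sum>j<d. v $ j * (\<Sum>i<d+2. x i $ j * w $ i))"
      by (subst sum.swap) (simp only: sum_distrib_left)
    also have "\<dots> = 0" using sj by (intro sum.neutral) simp
    finally show "(\<Sum>i<d+2. w $ i * (x i \<bullet> v - r)) = 0" using s0 by simp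
  qed
qed

text \<open>
  Radon's argument. Take an affine dependence \<open>l\<close> of \<open>d + 2\<close> of the points and a half-space that
  contains exactly those with \<open>l i > 0\<close>. Every term of \<open>\<Sum> l i (\<langle>x i, v\<rangle> - r) = 0\<close> is then nonnegative,
  hence zero. A negative \<open>l i\<close> would need \<open>\<langle>x i, v\<rangle> = r\<close> outside the closed half-space, so all \<open>l i\<close> are
  nonnegative with sum zero, which contradicts nontriviality.
\<close>

lemma halfspaces_not_shatter:
  assumes S: "S \<subseteq> carrier_vec d" "finite S" and c: "d + 2 \<le> card S"
  shows "\<not> shatters (halfspaces d) S"
proof
  assume sh: "shatters (halfspaces d) S"
  obtain S' where S': "S' \<subseteq> S" "card S' = d + 2" "finite S'"
    using obtain_subset_with_card_n[OF c] by metis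
  obtain x where x: "bij_betw x {..<d+2} S'"
    using ex_bij_betw_nat_finite[OF S'(3)] S'(2) by (auto simp: lessThan_atLeast0)
  have xS: "x i \<in> S" if "i < d+2" for i
    using x S'(1) that by (auto simp: bij_betw_def)
  obtain l where l: "\<exists>i<d+2. l i \<noteq> 0" "(\<Sum>i<d+2. l i) = 0"
    "\<And>v r. v \<in> carrier_vec d \<Longrightarrow> (\<Sum>i<d+2. l i * (x i \<bullet> v - r)) = 0"
    using affine_dependence[of d x] xS S(1) by blast
  define T where "T = x ` {i. i < d+2 \<and> 0 < l i}"
  have "T \<subseteq> S" using xS by (auto simp: T_def)
  then obtain f where f: "f \<in> halfspaces d" "\<And>y. y \<in> S \<Longrightarrow> f y = indicator T y"
    using sh unfolding shatters_def by blast
  then obtain v r where v: "v \<in> carrier_vec d" "f = (\<lambda>y. if r \<le> y \<bullet> v then 1 else 0)"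
    unfolding halfspaces_def by blast
  have inT: "x i \<in> T \<longleftrightarrow> 0 < l i" if "i < d+2" for i
    using that x unfolding T_def bij_betw_def by (auto dest: inj_onD)
  have side: "r \<le> x i \<bullet> v \<longleftrightarrow> 0 < l i" if "i < d+2" for i
    using f(2)[OF xS[OF that]] v(2) inT[OF that] by (auto split: if_splits simp: indicator_def)
  have nn: "0 \<le> l i * (x i \<bullet> v - r)" if "i < d+2" for i
    using side[OF that] by (cases "0 < l i") (auto intro: mult_nonneg_nonneg mult_nonpos_nonpos)
  have zero: "l i * (x i \<bullet> v - r) = 0" if "i < d+2" for i
    using l(3)[OF v(1), of r] nn that by (subst (asm) sum_nonneg_eq_0_iff) auto
  have "0 \<le> l i" if "i < d+2" for i
    using zero[OF that] side[OF that] by force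
  then have "l i = 0" if "i < d+2" for i
    using l(2) that by (subst (asm) sum_nonneg_eq_0_iff) auto
  with l(1) show False by blast
qed

lemma halfspaces_nonempty: "halfspaces d \<noteq> {}"
proof -
  have "(\<lambda>x. if 0 \<le> x \<bullet> 0\<^sub>v d then 1 else 0) \<in> halfspaces d"
    unfolding halfspaces_def using zero_carrier_vec[of d] by blast
  then show ?thesis by blast
qed

lemma VC_halfspaces:
  "finite (shattered_cards d (halfspaces d))" "VC d (halfspaces d) \<le> d + 1"
proof -
  have sub: "shattered_cards d (halfspaces d) \<subseteq> {..d+1}"
  proof
    fix c assume "c \<in> shattered_cards d (halfspaces d)"
    then obtain S where S: "c = card S" "S \<subseteq> carrier_vec d" "finite S" "shatters (halfspaces d) S"
      unfolding shattered_cards_def by blast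
    have "\<not> d + 2 \<le> card S" using halfspaces_not_shatter[OF S(2,3)] S(4) by blast
    then show "c \<in> {..d+1}" using S(1) by simp
  qed
  show fin: "finite (shattered_cards d (halfspaces d))" using finite_subset[OF sub] by simp
  have "shatters (halfspaces d) {}"
    unfolding shatters_def using halfspaces_nonempty[of d] by auto
  then have "shattered_cards d (halfspaces d) \<noteq> {}"
    unfolding shattered_cards_def by blast
  then show "VC d (halfspaces d) \<le> d + 1"
    unfolding VC_def using sub by (intro cSup_least) auto
qed

lemma space_borel_vec [simp]: "space (borel_vec d) = carrier_vec d"
  by (simp add: borel_vec_def)

lemma borel_vec_nth:
  assumes "j < d" shows "(\<lambda>x. x $ j) \<in> borel_measurable (borel_vec d)"
proof -
  have "(\<lambda>x. \<lambda>j\<in>{..<d}. x $ j) \<in> borel_vec d \<rightarrow>\<^sub>M PiM {..<d} (\<lambda>_. borel :: real measure)"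
    unfolding borel_vec_def
    by (rule measurable_vimage_algebra1) (auto simp: space_PiM)
  from measurable_compose[OF this measurable_component_singleton[of j "{..<d}"]] assms
  show ?thesis by simp
qed

lemma borel_vec_scalar_prod:
  assumes "v \<in> carrier_vec d" shows "(\<lambda>x. x \<bullet> v) \<in> borel_measurable (borel_vec d)"
  using assms borel_vec_nth unfolding scalar_prod_def
  by (intro borel_measurable_sum borel_measurable_times borel_measurable_const) auto

lemma measurable_borel_vecI:
  assumes "\<And>\<omega>. \<omega> \<in> space M \<Longrightarrow> f \<omega> \<in> carrier_vec d"
    and "\<And>j. j < d \<Longrightarrow> (\<lambda>\<omega>. f \<omega> $ j) \<in> borel_measurable M"
  shows "f \<in> M \<rightarrow>\<^sub>M borel_vec d"
  unfolding borel_vec_def using assms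
  by (intro measurable_vimage_algebra2) (auto intro!: measurable_restrict)

text \<open>
  A point on the boundary of the half-space must belong to the approximating ones eventually. So the
  thresholds approach \<open>r\<close> from below at rate \<open>e m = 1/(m+1)\<close>, while the rational normals approach \<open>v\<close> at
  the faster rate \<open>(e m)\<^sup>2\<close>; at each fixed \<open>x\<close> the error in the normal is eventually smaller than the
  slack in the threshold.
\<close>

lemma dense_halfspace:
  assumes v: "v \<in> carrier_vec d"
  obtains q :: "nat \<Rightarrow> real vec" and s :: "nat \<Rightarrow> real"
  where "\<And>m. q m \<in> carrier_vec d" "\<And>m j. j < d \<Longrightarrow> q m $ j \<in> \<rat>" "\<And>m. s m \<in> \<rat>"
    "\<And>x. x \<in> carrier_vec d \<Longrightarrow>
       (\<lambda>m. if s m \<le> x \<bullet> q m then 1 else 0 :: real) \<longlonglongrightarrow> (if r \<le> x \<bullet> v then 1 else 0)"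
proof -
  define e where "e m = 1 / (real m + 1)" for m :: nat
  have e0: "0 < e m" for m by (simp add: e_def)
  have elim: "e \<longlonglongrightarrow> 0" unfolding e_def using LIMSEQ_inverse_real_of_nat by (simp add: inverse_eq_divide add.commute)
  have "\<exists>q. q \<in> \<rat> \<and> \<bar>q - v $ j\<bar> < (e m)\<^sup>2" for m j
  proof -
    have "v $ j < v $ j + (e m)\<^sup>2" using e0[of m] by simp
    then obtain q where "q \<in> \<rat>" "v $ j < q" "q < v $ j + (e m)\<^sup>2" using Rats_dense_in_real by metis
    then show ?thesis by (intro exI[of _ q]) auto
  qed
  then have "\<exists>q'. \<forall>m j. q' m j \<in> \<rat> \<and> \<bar>q' m j - v $ j\<bar> < (e m)\<^sup>2"
    by (intro choice allI)
  then obtain q' where q': "\<And>m j. q' m j \<in> \<rat>" "\<And>m j. \<bar>q' m j - v $ j\<bar> < (e m)\<^sup>2" by blast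
  have "\<exists>t. t \<in> \<rat> \<and> r - 2 * e m < t \<and> t < r - e m" for m
    using Rats_dense_in_real[of "r - 2 * e m" "r - e m"] e0[of m] by auto
  then have "\<exists>s. \<forall>m. s m \<in> \<rat> \<and> r - 2 * e m < s m \<and> s m < r - e m"
    by (intro choice allI)
  then obtain s where s: "\<And>m. s m \<in> \<rat>" "\<And>m. r - 2 * e m < s m" "\<And>m. s m < r - e m" by blast
  define q where "q m = vec d (q' m)" for m
  show thesis
  proof (rule that[of q s])
    fix x :: "real vec" assume x: "x \<in> carrier_vec d"
    define L where "L = (\<Sum>j<d. \<bar>x $ j\<bar>)"
    have near: "\<bar>x \<bullet> q m - x \<bullet> v\<bar> \<le> L * (e m)\<^sup>2" for m
    proof -
      have "x \<bullet> q m - x \<bullet> v = (\<Sum>j<d. x $ j * (q' m j - v $ j))"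
        using v by (simp add: scalar_prod_def q_def lessThan_atLeast0 sum_subtractf right_diff_distrib)
      also have "\<bar>\<dots>\<bar> \<le> (\<Sum>j<d. \<bar>x $ j\<bar> * (e m)\<^sup>2)"
        by (rule order_trans[OF sum_abs], intro sum_mono)
           (simp add: abs_mult mult_left_mono less_imp_le q'(2))
      finally show ?thesis by (simp add: L_def sum_distrib_right)
    qed
    have "eventually (\<lambda>m. (s m \<le> x \<bullet> q m) = (r \<le> x \<bullet> v)) sequentially"
    proof (cases "r \<le> x \<bullet> v")
      case True
      have "(\<lambda>m. L * e m) \<longlonglongrightarrow> L * 0" by (intro tendsto_intros elim)
      then have "eventually (\<lambda>m. L * e m < 1) sequentially" by (rule order_tendstoD) simp
      then show ?thesis
      proof eventually_elim
        case (elim m)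
        then have "L * e m * e m \<le> 1 * e m" using e0[of m] by (intro mult_right_mono) auto
        with near[of m] s(3)[of m] True show ?case by (simp add: power2_eq_square)
      qed
    next
      case False
      have "(\<lambda>m. x \<bullet> v + L * (e m)\<^sup>2 + 2 * e m) \<longlonglongrightarrow> x \<bullet> v + L * 0\<^sup>2 + 2 * 0"
        by (intro tendsto_intros elim)
      then have "eventually (\<lambda>m. x \<bullet> v + L * (e m)\<^sup>2 + 2 * e m < r) sequentially"
        using False by (intro order_tendstoD) auto
      then show ?thesis
      proof eventually_elim
        case (elim m)
        with near[of m] s(2)[of m] False show ?case by simp
      qed
    qed
    then show "(\<lambda>m. if s m \<le> x \<bullet> q m then 1 else 0 :: real) \<longlonglongrightarrow> (if r \<le> x \<bullet> v then 1 else 0)"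
      by (intro tendsto_eventually) (auto elim: eventually_mono)
  qed (use s q' in \<open>simp_all add: q_def\<close>)
qed

lemma binary_class_halfspaces: "binary_class d (halfspaces d)"
  unfolding binary_class_def
proof (intro conjI)
  show "halfspaces d \<noteq> {}" by (rule halfspaces_nonempty)
  show "\<forall>f\<in>halfspaces d. f \<in> borel_measurable (borel_vec d) \<and> f ` carrier_vec d \<subseteq> {0, 1}"
  proof
    fix f assume "f \<in> halfspaces d"
    then obtain v r where v[measurable]: "v \<in> carrier_vec d" and f: "f = (\<lambda>y. if r \<le> y \<bullet> v then 1 else 0)"
      unfolding halfspaces_def by blast
    note [measurable] = borel_vec_scalar_prod[OF v]
    show "f \<in> borel_measurable (borel_vec d) \<and> f ` carrier_vec d \<subseteq> {0, 1}"
      unfolding f by auto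
  qed
  let ?Q = "{q. q \<in> carrier_vec d \<and> (\<forall>j<d. q $ j \<in> \<rat>)} :: real vec set"
  let ?g = "\<lambda>(v, r) (x :: real vec). if r \<le> x \<bullet> v then 1 else (0 :: real)"
  have "?Q \<subseteq> vec_of_list ` lists \<rat>"
  proof
    fix q assume q: "q \<in> ?Q"
    then have "list_of_vec q \<in> lists \<rat>" by (auto simp: in_set_conv_nth)
    then show "q \<in> vec_of_list ` lists \<rat>" by (metis image_eqI vec_list)
  qed
  then have "countable ?Q"
    by (rule countable_subset) (intro countable_image countable_lists countable_rat)
  then have cnt: "countable (?g ` (?Q \<times> \<rat>))"
    by (intro countable_image countable_SIGMA countable_rat)
  show "\<exists>G\<subseteq>halfspaces d. countable G \<and> (\<forall>f\<in>halfspaces d. \<exists>g. (\<forall>m::nat. g m \<in> G) \<and>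
          (\<forall>x\<in>carrier_vec d. (\<lambda>m. g m x) \<longlonglongrightarrow> f x))"
  proof (intro exI[of _ "?g ` (?Q \<times> \<rat>)"] conjI cnt ballI)
    show "?g ` (?Q \<times> \<rat>) \<subseteq> halfspaces d" by (auto simp: halfspaces_def)
    fix f assume "f \<in> halfspaces d"
    then obtain v r where v: "v \<in> carrier_vec d" and f: "f = (\<lambda>y. if r \<le> y \<bullet> v then 1 else 0)"
      unfolding halfspaces_def by blast
    obtain q s where qs: "\<And>m. q m \<in> carrier_vec d" "\<And>m j. j < d \<Longrightarrow> q m $ j \<in> \<rat>" "\<And>m. s m \<in> \<rat>"
      "\<And>x. x \<in> carrier_vec d \<Longrightarrow>
         (\<lambda>m. if s m \<le> x \<bullet> q m then 1 else 0 :: real) \<longlonglongrightarrow> (if r \<le> x \<bullet> v then 1 else 0)"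
      using dense_halfspace[OF v] by blast
    show "\<exists>g. (\<forall>m::nat. g m \<in> ?g ` (?Q \<times> \<rat>)) \<and> (\<forall>x\<in>carrier_vec d. (\<lambda>m. g m x) \<longlonglongrightarrow> f x)"
      using qs by (intro exI[of _ "\<lambda>m. ?g (q m, s m)"]) (auto simp: f)
  qed
qed

section \<open>Uniform deviation over half-spaces\<close>

text \<open>
  The inequality for half-spaces, transported from the product of the laws back to \<open>M\<close>: by
  independence, that product is the joint law of the \<open>Z k\<close>.
\<close>

lemma (in prob_space) uniform_halfspace_counts:
  assumes C: "VC_constant C" and d: "1 \<le> d" and K: "1 \<le> K"
    and ind: "indep_vars (\<lambda>_. borel_vec d) Z {..<K}" and u: "0 < u"
  obtains E where "E \<in> events" "1 - exp (- u) \<le> prob E"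
    "\<And>\<omega> (v :: real vec) (r :: real). \<omega> \<in> E \<Longrightarrow> v \<in> carrier_vec d \<Longrightarrow>
       real (card {k. k < K \<and> r \<le> Z k \<omega> \<bullet> v})
         \<le> (\<Sum>k<K. prob {\<omega> \<in> space M. r \<le> Z k \<omega> \<bullet> v})
           + C * (sqrt (real (d + 1) / real K) + sqrt (u / real K)) * real K"
proof -
  let ?Q = "\<lambda>k. distr M (borel_vec d) (Z k)" and ?F = "halfspaces d"
  let ?Z = "\<lambda>\<omega>. \<lambda>k\<in>{..<K}. Z k \<omega>"
  let ?avg = "\<lambda>y f. (1 / real K) * (\<Sum>i<K. f (y i) - (\<integral>x. f x \<partial>?Q i))"
  have Z: "Z k \<in> M \<rightarrow>\<^sub>M borel_vec d" if "k < K" for k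
    using ind that by (auto simp: indep_vars_def)
  have C0: "0 < C" using C by (simp add: VC_constant_def)
  have Q: "prob_space (?Q k) \<and> sets (?Q k) = sets (borel_vec d)" if "k < K" for k
    using prob_space_distr[OF Z[OF that]] by simp
  then have Qall: "\<forall>i<K. prob_space (?Q i) \<and> sets (?Q i) = sets (borel_vec d)" by blast
  have "\<exists>E\<in>sets (PiM {..<K} ?Q). measure (PiM {..<K} ?Q) E \<ge> 1 - exp (- u) \<and>
      (\<forall>y\<in>E. (SUP f\<in>?F. ?avg y f) \<le> C * (sqrt (real (VC d ?F) / real K) + sqrt (u / real K)))"
    by (rule C[unfolded VC_constant_def, THEN conjunct2, THEN spec[of _ d], THEN spec[of _ K],
          THEN spec[of _ ?Q], THEN spec[of _ ?F], THEN spec[of _ u], THEN mp, OF d, THEN mp, OF K,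
          THEN mp, OF Qall, THEN mp, OF binary_class_halfspaces, THEN mp, OF VC_halfspaces(1),
          THEN mp, OF u])
  then obtain E where E: "E \<in> sets (PiM {..<K} ?Q)" "measure (PiM {..<K} ?Q) E \<ge> 1 - exp (- u)"
    "\<And>y. y \<in> E \<Longrightarrow> (SUP f\<in>?F. ?avg y f) \<le> C * (sqrt (real (VC d ?F) / real K) + sqrt (u / real K))"
    by blast
  have law: "distr M (\<Pi>\<^sub>M k\<in>{..<K}. borel_vec d) ?Z = PiM {..<K} ?Q"
    using indep_vars_iff_distr_eq_PiM'[of "{..<K}" Z "\<lambda>_. borel_vec d"] ind Z K
    by (auto simp: lessThan_empty_iff)
  have Zm: "?Z \<in> M \<rightarrow>\<^sub>M (\<Pi>\<^sub>M k\<in>{..<K}. borel_vec d)"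
    using Z by (intro measurable_restrict) auto
  have Es: "E \<in> sets (\<Pi>\<^sub>M k\<in>{..<K}. borel_vec d)"
    using E(1) by (metis law sets_distr)
  show thesis
  proof (rule that[of "?Z -` E \<inter> space M"])
    show "?Z -` E \<inter> space M \<in> events" by (rule measurable_sets[OF Zm Es])
    show "1 - exp (- u) \<le> prob (?Z -` E \<inter> space M)"
      using E(2) by (simp add: law[symmetric] measure_distr[OF Zm Es])
    fix \<omega> and v :: "real vec" and r :: real
    assume om: "\<omega> \<in> ?Z -` E \<inter> space M" and v: "v \<in> carrier_vec d"
    let ?f = "\<lambda>x :: real vec. if r \<le> x \<bullet> v then 1 else (0 :: real)"
    have fF: "?f \<in> ?F" using v by (auto simp: halfspaces_def)
    have int01: "0 \<le> (\<integral>x. f x \<partial>?Q k) \<and> (\<integral>x. f x \<partial>?Q k) \<le> 1" if "f \<in> ?F" "k < K" for f k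
    proof -
      interpret Qk: prob_space "?Q k" using Q[OF that(2)] by simp
      have 01: "0 \<le> f x" "f x \<le> 1" for x
        using that(1) by (auto simp: halfspaces_def)
      have [measurable]: "f \<in> borel_measurable (borel_vec d)"
        using that(1) binary_class_halfspaces[of d] by (auto simp: binary_class_def)
      have "integrable (?Q k) f"
        by (rule Qk.integrable_const_bound[of _ 1]) (use 01 in auto)
      then have "(\<integral>x. f x \<partial>?Q k) \<le> (\<integral>x. 1 \<partial>?Q k)"
        by (intro integral_mono) (use 01 in auto)
      then show ?thesis using 01 Qk.prob_space by (auto intro: integral_nonneg)
    qed
    have intf: "(\<integral>x. ?f x \<partial>?Q k) = prob {\<omega> \<in> space M. r \<le> Z k \<omega> \<bullet> v}" if k: "k < K" for k
    proof -
      note [measurable] = borel_vec_scalar_prod[OF v] Z[OF k]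
      have "(\<integral>x. ?f x \<partial>?Q k) = (\<integral>\<omega>. ?f (Z k \<omega>) \<partial>M)"
        by (intro integral_distr) auto
      also have "\<dots> = (\<integral>\<omega>. indicator {\<omega> \<in> space M. r \<le> Z k \<omega> \<bullet> v} \<omega> \<partial>M)"
        by (intro Bochner_Integration.integral_cong) (auto simp: indicator_def)
      also have "\<dots> = prob {\<omega> \<in> space M. r \<le> Z k \<omega> \<bullet> v}" by simp
      finally show ?thesis .
    qed
    have "?avg (?Z \<omega>) ?f \<le> (SUP f\<in>?F. ?avg (?Z \<omega>) f)"
    proof (rule cSUP_upper[OF fF bdd_aboveI2])
      fix f assume f: "f \<in> ?F"
      have "(\<Sum>i<K. f (?Z \<omega> i) - (\<integral>x. f x \<partial>?Q i)) \<le> (\<Sum>i<K. 1)"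
      proof (intro sum_mono)
        fix i assume "i \<in> {..<K}"
        moreover have "f (?Z \<omega> i) \<le> 1" using f by (auto simp: halfspaces_def)
        ultimately show "f (?Z \<omega> i) - (\<integral>x. f x \<partial>?Q i) \<le> 1" using int01[OF f, of i] by simp
      qed
      then show "?avg (?Z \<omega>) f \<le> 1" using K by (simp add: divide_simps)
    qed
    also have "\<dots> \<le> C * (sqrt (real (VC d ?F) / real K) + sqrt (u / real K))"
      by (rule E(3)[OF IntD1[OF om, THEN vimageD]])
    also have "\<dots> \<le> C * (sqrt (real (d + 1) / real K) + sqrt (u / real K))"
      using C0 VC_halfspaces(2)[of d]
      by (intro mult_left_mono add_right_mono real_sqrt_le_mono divide_right_mono) auto
    finally have "(\<Sum>i<K. ?f (?Z \<omega> i) - (\<integral>x. ?f x \<partial>?Q i))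
        \<le> C * (sqrt (real (d + 1) / real K) + sqrt (u / real K)) * real K"
      using K by (simp add: divide_simps)
    moreover have "(\<Sum>i<K. ?f (?Z \<omega> i)) = real (card {k. k < K \<and> r \<le> Z k \<omega> \<bullet> v})"
    proof -
      have "(\<Sum>i<K. ?f (?Z \<omega> i)) = (\<Sum>i | i < K \<and> r \<le> Z i \<omega> \<bullet> v. 1)"
        by (rule sum.mono_neutral_cong_right) auto
      then show ?thesis by simp
    qed
    ultimately show "real (card {k. k < K \<and> r \<le> Z k \<omega> \<bullet> v})
         \<le> (\<Sum>k<K. prob {\<omega> \<in> space M. r \<le> Z k \<omega> \<bullet> v})
           + C * (sqrt (real (d + 1) / real K) + sqrt (u / real K)) * real K"
      by (simp add: sum_subtractf intf)
  qed
qed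

section \<open>Standardised block sums\<close>

text \<open>
  The vector whose scalar products with unit vectors have the tails \<open>std_tail\<close>.
\<close>

definition std_sum :: "nat \<Rightarrow> real mat \<Rightarrow> real vec \<Rightarrow> nat set \<Rightarrow> (nat \<Rightarrow> real vec) \<Rightarrow> real vec" where
  "std_sum d R \<mu> I x = vec d (\<lambda>j. (1 / sqrt (real (card I))) * (\<Sum>i\<in>I. (R *\<^sub>v (x i - \<mu>)) $ j))"

lemma std_sum_carrier [simp]: "std_sum d R \<mu> I x \<in> carrier_vec d"
  by (simp add: std_sum_def)

lemma std_sum_scalar_prod:
  assumes "v \<in> carrier_vec d"
  shows "std_sum d R \<mu> I x \<bullet> v = (1 / sqrt (real (card I))) * (\<Sum>i\<in>I. (R *\<^sub>v (x i - \<mu>)) \<bullet> v)"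
proof -
  have "(\<Sum>i\<in>I. (R *\<^sub>v (x i - \<mu>)) \<bullet> v) = (\<Sum>j<d. \<Sum>i\<in>I. (R *\<^sub>v (x i - \<mu>)) $ j * v $ j)"
    using assms by (simp add: scalar_prod_def[of _ v] lessThan_atLeast0 sum.swap[of _ I])
  then show ?thesis
    using assms by (simp add: std_sum_def scalar_prod_def[of _ v] lessThan_atLeast0
        sum_distrib_left sum_distrib_right mult_ac)
qed

lemma std_tail_eq:
  assumes "v \<in> carrier_vec d"
  shows "std_tail M R \<mu> Y I v r = measure M {\<omega> \<in> space M. r \<le> std_sum d R \<mu> I (\<lambda>i. Y i \<omega>) \<bullet> v}"
  unfolding std_tail_def std_sum_scalar_prod[OF assms] ..

lemma std_sum_restrict: "std_sum d R \<mu> I (restrict x I) = std_sum d R \<mu> I x"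
  by (simp add: std_sum_def cong: sum.cong)

lemma std_sum_measurable:
  assumes R: "R \<in> carrier_mat d d" and \<mu>: "\<mu> \<in> carrier_vec d"
  shows "std_sum d R \<mu> I \<in> PiM I (\<lambda>_. borel_vec d) \<rightarrow>\<^sub>M borel_vec d"
proof (rule measurable_borel_vecI)
  fix j assume j: "j < d"
  have "(\<lambda>x. (R *\<^sub>v (x i - \<mu>)) $ j) \<in> borel_measurable (PiM I (\<lambda>_. borel_vec d))" if "i \<in> I" for i
  proof -
    have "(\<lambda>x. x i $ l) \<in> borel_measurable (PiM I (\<lambda>_. borel_vec d))" if "l < d" for l
      using measurable_compose[OF measurable_component_singleton[OF \<open>i \<in> I\<close>] borel_vec_nth[OF that]] .
    then have "(\<lambda>x. \<Sum>l<d. R $$ (j, l) * (x i $ l - \<mu> $ l)) \<in> borel_measurable (PiM I (\<lambda>_. borel_vec d))"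
      by (intro borel_measurable_sum borel_measurable_times borel_measurable_diff borel_measurable_const) auto
    moreover have "(R *\<^sub>v (x i - \<mu>)) $ j = (\<Sum>l<d. R $$ (j, l) * (x i $ l - \<mu> $ l))" for x :: "nat \<Rightarrow> real vec"
      using R \<mu> j by (simp add: scalar_prod_def lessThan_atLeast0)
    ultimately show ?thesis by simp
  qed
  then have "(\<lambda>x. (1 / sqrt (real (card I))) * (\<Sum>i\<in>I. (R *\<^sub>v (x i - \<mu>)) $ j))
      \<in> borel_measurable (PiM I (\<lambda>_. borel_vec d))"
    by (intro borel_measurable_times borel_measurable_const borel_measurable_sum)
  then show "(\<lambda>x. std_sum d R \<mu> I x $ j) \<in> borel_measurable (PiM I (\<lambda>_. borel_vec d))"
    using j by (simp add: std_sum_def)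
qed simp

lemma (in prob_space) indep_vars_std_sum:
  assumes ind: "indep_vars (\<lambda>_. borel_vec d) Y {..<N}" and B: "equal_blocks N K B"
    and R: "R \<in> carrier_mat d d" and \<mu>: "\<mu> \<in> carrier_vec d"
  shows "indep_vars (\<lambda>_. borel_vec d) (\<lambda>k \<omega>. std_sum d R \<mu> (B k) (\<lambda>i. Y i \<omega>)) {..<K}"
proof -
  have 1: "indep_vars (\<lambda>k. PiM (B k) (\<lambda>_. borel_vec d)) (\<lambda>k \<omega>. restrict (\<lambda>i. Y i \<omega>) (B k)) {..<K}"
    using B by (intro indep_vars_restrict[OF ind]) (auto simp: equal_blocks_def)
  from indep_vars_compose2[OF 1 std_sum_measurable[OF R \<mu>]]
  show ?thesis by (simp add: std_sum_restrict)
qed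

lemma (in prob_space) W_quantile_bounds:
  assumes Y: "\<And>i. i < N \<Longrightarrow> Y i \<in> M \<rightarrow>\<^sub>M borel_vec d"
    and R: "R \<in> carrier_mat d d" and \<mu>: "\<mu> \<in> carrier_vec d" and v: "v \<in> carrier_vec d"
    and p: "0 < p" "p < 1"
  shows "p \<le> H_tail M N K R \<mu> Y v (W_quantile M N K R \<mu> Y v p)"
    and "W_quantile M N K R \<mu> Y v p < r \<Longrightarrow> H_tail M N K R \<mu> Y v r < p"
proof -
  let ?I = "{..<N div K}"
  let ?S = "\<lambda>\<omega>. std_sum d R \<mu> ?I (\<lambda>i. Y i \<omega>) \<bullet> v"
  have "(\<lambda>\<omega>. \<lambda>i\<in>?I. Y i \<omega>) \<in> M \<rightarrow>\<^sub>M PiM ?I (\<lambda>_. borel_vec d)"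
  proof (rule measurable_restrict)
    fix i assume "i \<in> ?I"
    then have "i < N div K" by simp
    also have "\<dots> \<le> N" by (rule div_le_dividend)
    finally show "Y i \<in> M \<rightarrow>\<^sub>M borel_vec d" by (rule Y)
  qed
  from measurable_compose[OF measurable_compose[OF this std_sum_measurable[OF R \<mu>]] borel_vec_scalar_prod[OF v]]
  have S: "?S \<in> borel_measurable M" by (simp add: std_sum_restrict)
  have H: "H_tail M N K R \<mu> Y v r = prob {\<omega> \<in> space M. r \<le> ?S \<omega>}" for r
    by (simp add: H_tail_def std_tail_eq[OF v])
  show "p \<le> H_tail M N K R \<mu> Y v (W_quantile M N K R \<mu> Y v p)"
    unfolding W_quantile_def H using tail_GREATEST(1)[OF S p] .
  show "H_tail M N K R \<mu> Y v r < p" if "W_quantile M N K R \<mu> Y v p < r"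
    unfolding H by (rule tail_GREATEST(2)[OF S p that[unfolded W_quantile_def H]])
qed

section \<open>Corruption of the blocks\<close>

text \<open>
  The blocks are disjoint, so choosing one modified index in each spoiled block is injective.
\<close>

lemma corrupted_blocks:
  assumes B: "equal_blocks N K B" and m: "card {i. i < N \<and> x i \<noteq> x' i} \<le> m"
  shows "card {k. k < K \<and> (\<exists>i\<in>B k. x i \<noteq> x' i)} \<le> m"
proof -
  let ?O = "{i. i < N \<and> x i \<noteq> x' i}" and ?J = "{k. k < K \<and> (\<exists>i\<in>B k. x i \<noteq> x' i)}"
  define g where "g k = (SOME i. i \<in> B k \<and> x i \<noteq> x' i)" for k
  have g: "g k \<in> B k" "x (g k) \<noteq> x' (g k)" if "k \<in> ?J" for k
    using that someI_ex[of "\<lambda>i. i \<in> B k \<and> x i \<noteq> x' i"] by (auto simp: g_def)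
  have "inj_on g ?J"
  proof (rule inj_onI)
    fix k l assume kl: "k \<in> ?J" "l \<in> ?J" "g k = g l"
    then have "B k \<inter> B l \<noteq> {}" using g(1)[of k] g(1)[of l] by auto
    then show "k = l"
      using B kl by (auto simp: equal_blocks_def disjoint_family_on_def)
  qed
  moreover have "g ` ?J \<subseteq> ?O"
    using g B unfolding equal_blocks_def by blast
  ultimately have "card ?J \<le> card ?O" by (intro card_inj_on_le) auto
  with m show ?thesis by simp
qed

text \<open>
  The bound on the number of blocks below \<open>r\<close> comes from the opposite closed half-space, with normal
  \<open>- v\<close> and threshold \<open>- r'\<close> for some \<open>r' < r\<close> such that no uncorrupted projection lies strictly between
  \<open>r'\<close> and \<open>r\<close>.
\<close>

lemma (in prob_space) corrupted_empirical_tail: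
  assumes C: "VC_constant C" and d: "1 \<le> d" and K: "1 \<le> K"
    and B: "equal_blocks N K B" and ind: "indep_vars (\<lambda>_. borel_vec d) Y {..<N}"
    and R: "R \<in> carrier_mat d d" and \<mu>: "\<mu> \<in> carrier_vec d"
    and law: "common_block_law M N d K B R \<mu> Y" and corr: "corrupted M N d m Y X" and u: "0 < u"
  obtains E where "E \<in> events" "1 - exp (- u) \<le> prob E"
    "\<And>\<omega> v. \<omega> \<in> E \<Longrightarrow> v \<in> carrier_vec d \<Longrightarrow> norm2 v = 1 \<Longrightarrow>
       empirical_tail K (\<lambda>k. std_sum d R \<mu> (B k) (\<lambda>i. X i \<omega>) \<bullet> v) (H_tail M N K R \<mu> Y v)
         (C * (sqrt (real (d + 1) / real K) + sqrt (u / real K)) + real m / real K)"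
proof -
  let ?Z = "\<lambda>k \<omega>. std_sum d R \<mu> (B k) (\<lambda>i. Y i \<omega>)"
  let ?\<delta> = "C * (sqrt (real (d + 1) / real K) + sqrt (u / real K))"
  have Zind: "indep_vars (\<lambda>_. borel_vec d) ?Z {..<K}"
    by (rule indep_vars_std_sum[OF ind B R \<mu>])
  obtain E where E: "E \<in> events" "1 - exp (- u) \<le> prob E"
    and cnt: "\<And>\<omega> v r. \<omega> \<in> E \<Longrightarrow> v \<in> carrier_vec d \<Longrightarrow>
       real (card {k. k < K \<and> r \<le> ?Z k \<omega> \<bullet> v})
         \<le> (\<Sum>k<K. prob {\<omega> \<in> space M. r \<le> ?Z k \<omega> \<bullet> v}) + ?\<delta> * real K"
    using uniform_halfspace_counts[OF C d K Zind u] by blast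
  show thesis
  proof (rule that[OF E])
    fix \<omega> v assume om: "\<omega> \<in> E" and v: "v \<in> carrier_vec d" "norm2 v = 1"
    let ?H = "H_tail M N K R \<mu> Y v"
    let ?y = "\<lambda>k. std_sum d R \<mu> (B k) (\<lambda>i. X i \<omega>) \<bullet> v"
    let ?J = "{k. k < K \<and> (\<exists>i\<in>B k. X i \<omega> \<noteq> Y i \<omega>)}"
    have omS: "\<omega> \<in> space M" using om sets.sets_into_space[OF E(1)] by blast
    have J: "card ?J \<le> m"
      using corr omS by (intro corrupted_blocks[OF B]) (auto simp: corrupted_def)
    have tail: "prob {\<omega> \<in> space M. r \<le> ?Z k \<omega> \<bullet> v} = ?H r" if "k < K" for k r
      using law that v std_tail_eq[OF v(1), of M R \<mu> Y "B k" r] by (simp add: common_block_law_def)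
    have same: "?y k = ?Z k \<omega> \<bullet> v" if "k < K" "k \<notin> ?J" for k
      using that by (simp add: std_sum_def cong: sum.cong)
    have corrupt: "real (card {k. k < K \<and> P (?y k)}) \<le> (q + (?\<delta> + real m / real K)) * real K"
      if "real (card {k. k < K \<and> P (?Z k \<omega> \<bullet> v)}) \<le> real K * q + ?\<delta> * real K" for P q
    proof -
      have "{k. k < K \<and> P (?y k)} \<subseteq> {k. k < K \<and> P (?Z k \<omega> \<bullet> v)} \<union> ?J"
        using same by fastforce
      then have "card {k. k < K \<and> P (?y k)} \<le> card ({k. k < K \<and> P (?Z k \<omega> \<bullet> v)} \<union> ?J)"
        by (intro card_mono) auto
      also have "\<dots> \<le> card {k. k < K \<and> P (?Z k \<omega> \<bullet> v)} + card ?J" by (rule card_Un_le)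
      finally have "real (card {k. k < K \<and> P (?y k)}) \<le> (real K * q + ?\<delta> * real K) + real m"
        using that J by linarith
      also have "real K * q + t * real K + real m = (q + (t + real m / real K)) * real K" for t
        using K by (simp add: field_simps)
      finally show ?thesis .
    qed
    show "empirical_tail K ?y ?H (?\<delta> + real m / real K)"
    proof
      show "0 < K" using K by simp
    next
      fix r
      have "(\<Sum>k<K. prob {\<omega> \<in> space M. r \<le> ?Z k \<omega> \<bullet> v}) = real K * ?H r"
        by (simp add: tail)
      then show "real (card {k. k < K \<and> r \<le> ?y k}) \<le> (?H r + (?\<delta> + real m / real K)) * real K"
        using cnt[OF om v(1), of r] by (intro corrupt) simp
    next
      fix r
      obtain r' where r': "r' < r" "\<And>k. k < K \<Longrightarrow> ?Z k \<omega> \<bullet> v < r \<Longrightarrow> ?Z k \<omega> \<bullet> v \<le> r'"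
        using finite_gap_below[of r K "\<lambda>k. ?Z k \<omega> \<bullet> v"] by blast
      have neg: "z \<bullet> (- v) = - (z \<bullet> v)" if "z \<in> carrier_vec d" for z
        using that v(1) by simp
      have negv: "- v \<in> carrier_vec d" using v(1) by simp
      have "prob {\<omega> \<in> space M. - r' \<le> ?Z k \<omega> \<bullet> (- v)} \<le> 1 - ?H r" if k: "k < K" for k
      proof -
        have Zk: "?Z k \<in> M \<rightarrow>\<^sub>M borel_vec d" using Zind k by (auto simp: indep_vars_def)
        note [measurable] = measurable_compose[OF Zk borel_vec_scalar_prod[OF v(1)]]
        have ev: "{\<omega> \<in> space M. r \<le> ?Z k \<omega> \<bullet> v} \<in> events" by measurable
        have "prob {\<omega> \<in> space M. - r' \<le> ?Z k \<omega> \<bullet> (- v)}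
            \<le> prob (space M - {\<omega> \<in> space M. r \<le> ?Z k \<omega> \<bullet> v})"
          using r'(1) ev by (intro finite_measure_mono) (auto simp: neg)
        also have "\<dots> = 1 - ?H r" using prob_compl[OF ev] tail[OF k] by simp
        finally show ?thesis .
      qed
      then have "(\<Sum>k<K. prob {\<omega> \<in> space M. - r' \<le> ?Z k \<omega> \<bullet> (- v)}) \<le> (\<Sum>k<K. 1 - ?H r)"
        by (intro sum_mono) simp
      then have "real (card {k. k < K \<and> - r' \<le> ?Z k \<omega> \<bullet> (- v)}) \<le> real K * (1 - ?H r) + ?\<delta> * real K"
        using cnt[OF om negv, of "- r'"] by simp
      moreover have "card {k. k < K \<and> ?Z k \<omega> \<bullet> v < r} \<le> card {k. k < K \<and> - r' \<le> ?Z k \<omega> \<bullet> (- v)}"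
        using r'(2) by (intro card_mono) (auto simp: neg)
      ultimately have "real (card {k. k < K \<and> ?Z k \<omega> \<bullet> v < r}) \<le> real K * (1 - ?H r) + ?\<delta> * real K"
        by linarith
      then show "real (card {k. k < K \<and> ?y k < r}) \<le> (1 - ?H r + (?\<delta> + real m / real K)) * real K"
        by (rule corrupt)
    qed
  qed
qed

section \<open>The outlyingness in standardised coordinates\<close>

lemma norm2_pos:
  assumes "w \<in> carrier_vec d" "w \<noteq> 0\<^sub>v d"
  shows "0 < norm2 w"
proof -
  obtain j where j: "j < d" "w $ j \<noteq> 0"
    using assms by (metis carrier_vecD eq_vecI index_zero_vec)
  have "0 < (w $ j)\<^sup>2" using j by simp
  also have "\<dots> \<le> (\<Sum>i<d. (w $ i)\<^sup>2)" using j by (intro member_le_sum) auto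
  also have "\<dots> = w \<bullet> w"
    using assms(1) by (simp add: scalar_prod_def lessThan_atLeast0 power2_eq_square)
  finally show ?thesis by (simp add: norm2_def)
qed

lemma unit_direction:
  assumes "w \<in> carrier_vec d" "w \<noteq> 0\<^sub>v d"
  obtains e where "e \<in> carrier_vec d" "norm2 e = 1" "w = norm2 w \<cdot>\<^sub>v e" "w \<bullet> e = norm2 w"
proof -
  let ?t = "norm2 w" and ?e = "(1 / norm2 w) \<cdot>\<^sub>v w"
  have t: "0 < ?t" by (rule norm2_pos[OF assms])
  have sq: "w \<bullet> w = ?t * ?t" using t by (simp add: norm2_def)
  show thesis
  proof (rule that[of ?e])
    show "?e \<in> carrier_vec d" using assms by simp
    show we: "w \<bullet> ?e = ?t" using assms t by (simp add: sq)
    show "norm2 ?e = 1" unfolding norm2_def[of ?e] using assms t by (simp add: sq)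
    show "w = ?t \<cdot>\<^sub>v ?e" using t by (simp add: smult_smult_assoc)
  qed
qed

lemma block_mean_scalar_prod:
  assumes v: "v \<in> carrier_vec d" and x: "\<And>i. i \<in> B k \<Longrightarrow> x i \<in> carrier_vec d"
  shows "block_mean d B x k \<bullet> v = (\<Sum>i\<in>B k. x i \<bullet> v) / real (card (B k))"
proof -
  have "(\<Sum>i\<in>B k. x i \<bullet> v) = (\<Sum>j<d. \<Sum>i\<in>B k. x i $ j * v $ j)"
    using assms by (simp add: scalar_prod_def[of _ v] lessThan_atLeast0 sum.swap[of _ "B k"])
  then show ?thesis
    using v by (simp add: block_mean_def scalar_prod_def[of _ v] lessThan_atLeast0
        sum_divide_distrib sum_distrib_right)
qed

lemma symmetric_scalar_prod:
  assumes "R \<in> carrier_mat d d" "transpose_mat R = R" "x \<in> carrier_vec d" "e \<in> carrier_vec d"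
  shows "x \<bullet> (R *\<^sub>v e) = (R *\<^sub>v x) \<bullet> (e :: real vec)"
  using transpose_vec_mult_scalar[OF assms(1,4,3)] assms(2) by simp

locale standardisation =
  fixes d n :: nat and B :: "nat \<Rightarrow> nat set" and K :: nat and \<Sigma> R :: "real mat" and \<mu> :: "real vec"
    and x :: "nat \<Rightarrow> real vec"
  assumes R: "is_inv_sqrt d \<Sigma> R" and Sigma: "\<Sigma> \<in> carrier_mat d d" and mu: "\<mu> \<in> carrier_vec d"
    and n: "0 < n" and K: "0 < K" and card_B: "\<And>k. k < K \<Longrightarrow> card (B k) = n"
    and x: "\<And>k i. k < K \<Longrightarrow> i \<in> B k \<Longrightarrow> x i \<in> carrier_vec d"
begin

abbreviation proj :: "real vec \<Rightarrow> nat \<Rightarrow> real" where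
  "proj e k \<equiv> std_sum d R \<mu> (B k) x \<bullet> e"

abbreviation MAD :: "real vec \<Rightarrow> real" where
  "MAD e \<equiv> Med K (\<lambda>k. \<bar>proj e k - Med K (proj e)\<bar>)"

lemma R_carrier: "R \<in> carrier_mat d d" and R_sym: "transpose_mat R = R"
  using R by (auto simp: is_inv_sqrt_def)

lemma R_mult [simp]: "v \<in> carrier_vec d \<Longrightarrow> R *\<^sub>v v \<in> carrier_vec d"
  using R_carrier by simp

lemma R_zero [simp]: "R *\<^sub>v 0\<^sub>v d = 0\<^sub>v d"
  using R_carrier by (intro eq_vecI) auto

text \<open>
  The preimage of \<open>v\<close> is \<open>R \<Sigma> v\<close>, since \<open>R\<^sup>2 \<Sigma> = 1\<close>. Hence every nonzero direction has the form \<open>t R e\<close> with \<open>t > 0\<close> and \<open>e\<close> a unit vector.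
\<close>

lemma R_surj:
  assumes "v \<in> carrier_vec d" shows "\<exists>w\<in>carrier_vec d. v = R *\<^sub>v w"
proof -
  have "(R * R) * \<Sigma> = 1\<^sub>m d" using R by (simp add: is_inv_sqrt_def)
  moreover have "(R * R) * \<Sigma> *\<^sub>v v = R *\<^sub>v (R *\<^sub>v (\<Sigma> *\<^sub>v v))"
    using assms R_carrier Sigma by (simp add: assoc_mult_mat_vec[of _ d d _ d])
  ultimately have "v = R *\<^sub>v (R *\<^sub>v (\<Sigma> *\<^sub>v v))" using assms by simp
  moreover have "R *\<^sub>v (\<Sigma> *\<^sub>v v) \<in> carrier_vec d" using assms Sigma by simp
  ultimately show ?thesis by blast
qed

lemma R_inj:
  assumes "e \<in> carrier_vec d" "R *\<^sub>v e = 0\<^sub>v d" shows "e = 0\<^sub>v d"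
proof -
  have "\<Sigma> * (R * R) = 1\<^sub>m d" using R by (simp add: is_inv_sqrt_def)
  moreover have "\<Sigma> * (R * R) *\<^sub>v e = \<Sigma> *\<^sub>v (R *\<^sub>v (R *\<^sub>v e))"
    using assms(1) R_carrier Sigma by (simp add: assoc_mult_mat_vec[of _ d d _ d])
  ultimately have "e = \<Sigma> *\<^sub>v (R *\<^sub>v (R *\<^sub>v e))" using assms(1) by simp
  also have "\<dots> = 0\<^sub>v d" using assms(2) Sigma by (intro eq_vecI) auto
  finally show ?thesis .
qed

lemma direction_scalar_prod:
  assumes e: "e \<in> carrier_vec d" and \<nu>: "\<nu> \<in> carrier_vec d"
  shows "\<nu> \<bullet> (t \<cdot>\<^sub>v (R *\<^sub>v e)) = \<mu> \<bullet> (t \<cdot>\<^sub>v (R *\<^sub>v e)) + t * ((R *\<^sub>v (\<nu> - \<mu>)) \<bullet> e)"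
proof -
  have "(R *\<^sub>v (\<nu> - \<mu>)) \<bullet> e = (\<nu> - \<mu>) \<bullet> (R *\<^sub>v e)"
    using symmetric_scalar_prod[OF R_carrier R_sym _ e] \<nu> mu by simp
  also have "\<dots> = \<nu> \<bullet> (R *\<^sub>v e) - \<mu> \<bullet> (R *\<^sub>v e)"
    using minus_scalar_prod_distrib[OF \<nu> mu] e by simp
  finally have "\<nu> \<bullet> (R *\<^sub>v e) = \<mu> \<bullet> (R *\<^sub>v e) + (R *\<^sub>v (\<nu> - \<mu>)) \<bullet> e" by simp
  then have "t * (\<nu> \<bullet> (R *\<^sub>v e)) = t * (\<mu> \<bullet> (R *\<^sub>v e)) + t * ((R *\<^sub>v (\<nu> - \<mu>)) \<bullet> e)"
    by (simp only: distrib_left)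
  then show ?thesis using e \<nu> mu by simp
qed

text \<open>
  In the direction \<open>v = t R e\<close> every projected block mean is the same increasing affine function of
  the standardised projection \<open>proj e k\<close>, with slope \<open>s = t / sqrt n\<close>. Medians commute with it, the
  constant \<open>\<langle>\<mu>, v\<rangle>\<close> cancels in the differences, and \<open>s\<close> cancels in the quotient.
\<close>

lemma SDO_ratio:
  assumes e: "e \<in> carrier_vec d" and \<nu>: "\<nu> \<in> carrier_vec d" and t: "0 < t" and pos: "0 < MAD e"
  defines "v \<equiv> t \<cdot>\<^sub>v (R *\<^sub>v e)"
  shows "(let m = Med K (\<lambda>k. block_mean d B x k \<bullet> v)
           in ereal \<bar>\<nu> \<bullet> v - m\<bar> / ereal (Med K (\<lambda>k. \<bar>block_mean d B x k \<bullet> v - m\<bar>)))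
       = ereal (\<bar>sqrt (real n) * ((R *\<^sub>v (\<nu> - \<mu>)) \<bullet> e) - Med K (proj e)\<bar> / MAD e)"
proof -
  define c where "c = \<mu> \<bullet> v"
  define s where "s = t / sqrt (real n)"
  define m where "m = Med K (\<lambda>k. block_mean d B x k \<bullet> v)"
  have s: "0 < s" using t n by (simp add: s_def)
  have v: "v \<in> carrier_vec d" using e by (simp add: v_def)
  have bm: "block_mean d B x k \<bullet> v = c + s * proj e k" if k: "k < K" for k
  proof -
    have "block_mean d B x k \<bullet> v = (\<Sum>i\<in>B k. x i \<bullet> v) / real n"
      using block_mean_scalar_prod[OF v x[OF k]] card_B[OF k] by simp
    also have "(\<Sum>i\<in>B k. x i \<bullet> v) = (\<Sum>i\<in>B k. c + t * ((R *\<^sub>v (x i - \<mu>)) \<bullet> e))"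
      unfolding c_def v_def using e x[OF k] by (intro sum.cong direction_scalar_prod) auto
    also have "\<dots> = real n * c + t * (\<Sum>i\<in>B k. (R *\<^sub>v (x i - \<mu>)) \<bullet> e)"
      using card_B[OF k] by (simp add: sum.distrib sum_distrib_left)
    also have "(\<Sum>i\<in>B k. (R *\<^sub>v (x i - \<mu>)) \<bullet> e) = sqrt (real n) * proj e k"
      using n card_B[OF k] by (simp add: std_sum_scalar_prod[OF e])
    also have "(real n * c + t * (sqrt (real n) * proj e k)) / real n = c + s * proj e k"
    proof -
      have "real n = sqrt (real n) * sqrt (real n)" by simp
      then have "t * sqrt (real n) / real n = s"
        unfolding s_def using n by (metis mult_divide_mult_cancel_right of_nat_0_less_iff real_sqrt_gt_0_iff less_irrefl)
      moreover have "t * (sqrt (real n) * proj e k) / real n = t * sqrt (real n) / real n * proj e k"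
        by simp
      ultimately show ?thesis using n by (simp only: add_divide_distrib) simp
    qed
    finally show ?thesis .
  qed
  have Med_cong: "Med K z = Med K z'" if "\<And>k. k < K \<Longrightarrow> z k = z' k" for z z'
  proof -
    have "map z [0..<K] = map z' [0..<K]" using that by simp
    then show ?thesis by (simp only: Med_def)
  qed
  have m: "m = c + s * Med K (proj e)"
    unfolding m_def using Med_affine[of s K c] s K Med_cong[OF bm] by simp
  have "Med K (\<lambda>k. \<bar>block_mean d B x k \<bullet> v - m\<bar>) = Med K (\<lambda>k. 0 + s * \<bar>proj e k - Med K (proj e)\<bar>)"
  proof (rule Med_cong)
    fix k assume "k < K"
    then have "block_mean d B x k \<bullet> v - m = s * (proj e k - Med K (proj e))"
      by (simp add: bm m algebra_simps)
    then show "\<bar>block_mean d B x k \<bullet> v - m\<bar> = 0 + s * \<bar>proj e k - Med K (proj e)\<bar>"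
      using s by (simp add: abs_mult)
  qed
  also have "\<dots> = s * MAD e" using s K by (subst Med_affine) auto
  finally have den: "Med K (\<lambda>k. \<bar>block_mean d B x k \<bullet> v - m\<bar>) = s * MAD e" .
  have "\<nu> \<bullet> v - m = t * ((R *\<^sub>v (\<nu> - \<mu>)) \<bullet> e) - s * Med K (proj e)"
    using direction_scalar_prod[OF e \<nu>, of t] by (simp add: m c_def v_def)
  also have "\<dots> = s * (sqrt (real n) * ((R *\<^sub>v (\<nu> - \<mu>)) \<bullet> e) - Med K (proj e))"
    using n by (simp add: s_def right_diff_distrib)
  finally have num: "\<bar>\<nu> \<bullet> v - m\<bar> = s * \<bar>sqrt (real n) * ((R *\<^sub>v (\<nu> - \<mu>)) \<bullet> e) - Med K (proj e)\<bar>"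
    using s by (simp add: abs_mult)
  show ?thesis
    unfolding Let_def m_def[symmetric] num den using s pos by simp
qed

text \<open>
  At \<open>\<mu>\<close> each quotient is \<open>\<bar>Med\<bar> / MAD \<le> \<rho>/\<phi>\<^sub>l\<close>, and a minimiser can only do better. In the direction
  \<open>e\<close> of its own standardised error \<open>z = sqrt n R (\<nu> - \<mu>)\<close> the quotient is at least
  \<open>(\<parallel>z\<parallel> - \<rho>) / \<phi>\<^sub>u\<close>. The final bound absorbs \<open>\<rho>\<close> into \<open>\<rho> \<phi>\<^sub>u/\<phi>\<^sub>l\<close>.
\<close>

lemma SDO_argmin_bound:
  assumes Med: "\<And>e. e \<in> carrier_vec d \<Longrightarrow> norm2 e = 1 \<Longrightarrow> \<bar>Med K (proj e)\<bar> \<le> \<rho>"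
    and lo: "\<And>e. e \<in> carrier_vec d \<Longrightarrow> norm2 e = 1 \<Longrightarrow> \<phi>\<^sub>l \<le> MAD e"
    and up: "\<And>e. e \<in> carrier_vec d \<Longrightarrow> norm2 e = 1 \<Longrightarrow> MAD e \<le> \<phi>\<^sub>u"
    and pos: "0 < \<phi>\<^sub>l" "\<phi>\<^sub>l \<le> \<phi>\<^sub>u" "0 \<le> \<rho>"
    and argmin: "is_arg_min (SDO d K B x) (\<lambda>\<nu>. \<nu> \<in> carrier_vec d) \<nu>"
  shows "sqrt (real n) * norm2 (R *\<^sub>v (\<nu> - \<mu>)) \<le> 2 * (\<rho> * (\<phi>\<^sub>u / \<phi>\<^sub>l))"
proof -
  have \<nu>: "\<nu> \<in> carrier_vec d" and le: "SDO d K B x \<nu> \<le> SDO d K B x \<mu>"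
    using argmin mu by (auto simp: is_arg_min_def not_less)
  have "SDO d K B x \<mu> \<le> ereal (\<rho> / \<phi>\<^sub>l)"
    unfolding SDO_def
  proof (rule SUP_least)
    fix v :: "real vec" assume v: "v \<in> carrier_vec d - {0\<^sub>v d}"
    obtain w where w: "w \<in> carrier_vec d" "v = R *\<^sub>v w" using R_surj v by blast
    then have w0: "w \<noteq> 0\<^sub>v d" using v R_carrier by auto
    obtain e where e: "e \<in> carrier_vec d" "norm2 e = 1" "w = norm2 w \<cdot>\<^sub>v e"
      using unit_direction[OF w(1) w0] by blast
    have ve: "v = norm2 w \<cdot>\<^sub>v (R *\<^sub>v e)"
      using w(2) e mult_mat_vec[OF R_carrier e(1)] by metis
    have Mpos: "0 < MAD e" using lo[OF e(1,2)] pos(1) by linarith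
    have "R *\<^sub>v (\<mu> - \<mu>) = 0\<^sub>v d" using mu R_carrier by simp
    then have 0: "(R *\<^sub>v (\<mu> - \<mu>)) \<bullet> e = 0" using e(1) by simp
    have "\<bar>Med K (proj e)\<bar> / MAD e \<le> \<rho> / \<phi>\<^sub>l"
      using Med[OF e(1,2)] lo[OF e(1,2)] pos by (intro frac_le) auto
    then show "(let m = Med K (\<lambda>k. block_mean d B x k \<bullet> v)
        in ereal \<bar>\<mu> \<bullet> v - m\<bar> / ereal (Med K (\<lambda>k. \<bar>block_mean d B x k \<bullet> v - m\<bar>))) \<le> ereal (\<rho> / \<phi>\<^sub>l)"
      unfolding ve SDO_ratio[OF e(1) mu norm2_pos[OF w(1) w0] Mpos] 0 by simp
  qed
  with le have SDO_le: "SDO d K B x \<nu> \<le> ereal (\<rho> / \<phi>\<^sub>l)" by (rule order_trans)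
  let ?z = "R *\<^sub>v (\<nu> - \<mu>)"
  define t where "t = \<rho> * (\<phi>\<^sub>u / \<phi>\<^sub>l)"
  have z: "?z \<in> carrier_vec d" using \<nu> mu by simp
  show ?thesis
  proof (cases "?z = 0\<^sub>v d")
    case True
    then show ?thesis using pos by (simp add: norm2_def)
  next
    case False
    obtain e where e: "e \<in> carrier_vec d" "norm2 e = 1" "?z \<bullet> e = norm2 ?z"
      using unit_direction[OF z False] by blast
    have "e \<noteq> 0\<^sub>v d" using e(2) by (auto simp: norm2_def)
    then have nz: "1 \<cdot>\<^sub>v (R *\<^sub>v e) \<in> carrier_vec d - {0\<^sub>v d}"
      using R_inj[OF e(1)] e(1) by auto
    have Mpos: "0 < MAD e" using lo[OF e(1,2)] pos(1) by linarith
    let ?q = "\<bar>sqrt (real n) * norm2 ?z - Med K (proj e)\<bar>"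
    have one: "(0 :: real) < 1" by simp
    have "ereal (?q / MAD e) \<le> SDO d K B x \<nu>"
      unfolding SDO_def SDO_ratio[OF e(1) \<nu> _ Mpos, of 1, unfolded e(3), OF one, symmetric]
      by (rule SUP_upper[OF nz])
    with SDO_le have "?q / MAD e \<le> \<rho> / \<phi>\<^sub>l" using order_trans ereal_less_eq(3) by blast
    then have "?q \<le> \<rho> / \<phi>\<^sub>l * MAD e" using Mpos by (simp add: divide_le_eq)
    also have "\<dots> \<le> \<rho> / \<phi>\<^sub>l * \<phi>\<^sub>u"
      using up[OF e(1,2)] pos by (intro mult_left_mono) auto
    finally have "sqrt (real n) * norm2 ?z \<le> \<rho> + t"
      using Med[OF e(1,2)] by (simp add: t_def)
    moreover have "\<rho> * 1 \<le> t"
      unfolding t_def using pos by (intro mult_left_mono) auto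
    ultimately show ?thesis unfolding t_def[symmetric] by linarith
  qed
qed

end

section \<open>Constants and rate\<close>

text \<open>
  Here \<open>g\<close>, \<open>p\<close>, \<open>q\<close>, \<open>r\<close> stand for \<open>sqrt ((d+1)/K)\<close>, \<open>sqrt (d/K)\<close>, \<open>sqrt (u/K)\<close> and \<open>m/K\<close>, so that
  \<open>C (g + q) + r\<close> is the deviation \<open>\<delta>\<close>. The three conclusions are what the proof needs of it:
  \<open>\<delta> \<le> \<epsilon>\<close>, the radius \<open>\<rho>\<close> lies in the range where the tail is known to decay, and \<open>\<rho>\<close> has the
  right order.
\<close>

lemma rate_constants:
  fixes C a\<^sub>0 a\<^sub>1 a\<^sub>2 :: real
  assumes pos: "0 < C" "0 < a\<^sub>0" "0 < a\<^sub>1" "0 < a\<^sub>2"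
  obtains s D :: real where "0 < s" "0 < D"
    "\<And>\<epsilon> g p q r. 0 < \<epsilon> \<Longrightarrow> \<epsilon> \<le> 1 \<Longrightarrow> 0 \<le> g \<Longrightarrow> g \<le> 2 * p \<Longrightarrow> p \<le> s * \<epsilon> \<Longrightarrow> 0 \<le> q \<Longrightarrow> q \<le> s * \<epsilon> \<Longrightarrow>
       0 \<le> r \<Longrightarrow> r \<le> s * \<epsilon> \<Longrightarrow>
       C * (g + q) + r \<le> \<epsilon> \<and>
       2 * C / a\<^sub>1 * g + 2 / a\<^sub>2 * (C * (g + q) + r) \<le> a\<^sub>0 \<and>
       2 * C / a\<^sub>1 * g + 2 / a\<^sub>2 * (C * (g + q) + r) \<le> D * (p + q + r)"
proof -
  define D where "D = 4 * C / a\<^sub>1 + 2 / a\<^sub>2 * (3 * C + 1)"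
  \<comment> \<open>Small enough for both \<open>(3C + 1) s \<le> 1\<close> and \<open>D s \<le> a\<^sub>0\<close>.\<close>
  define s where "s = 1 / (3 * C + 1 + D / a\<^sub>0)"
  have D: "0 < D" using pos by (auto simp: D_def intro!: add_pos_pos)
  then have q: "0 < D / a\<^sub>0" using pos by simp
  then have s: "0 < s" using pos by (simp add: s_def add_pos_pos)
  have sum1: "(3 * C + 1) * s + D / a\<^sub>0 * s = 1"
    unfolding distrib_right[symmetric] s_def using pos q by simp
  have s1: "(3 * C + 1) * s \<le> 1"
    using sum1 mult_pos_pos[OF q s] by linarith
  have "0 < (3 * C + 1) * s" using pos s by simp
  then have "D / a\<^sub>0 * s \<le> 1" using sum1 by linarith
  then have s2: "D * s \<le> a\<^sub>0" using pos by (simp add: divide_le_eq)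
  show thesis
  proof (rule that[OF s D])
    fix \<epsilon> g p q r :: real
    assume e: "0 < \<epsilon>" "\<epsilon> \<le> 1" and g: "0 \<le> g" "g \<le> 2 * p" "p \<le> s * \<epsilon>"
      and q: "0 \<le> q" "q \<le> s * \<epsilon>" and r: "0 \<le> r" "r \<le> s * \<epsilon>"
    let ?\<delta> = "C * (g + q) + r" and ?t = "p + q + r"
    have p: "0 \<le> p" using g by simp
    have split: "2 * C / a\<^sub>1 * g + 2 / a\<^sub>2 * ?\<delta> \<le> D * b"
      if "g \<le> 2 * b" "?\<delta> \<le> (3 * C + 1) * b" for b
    proof -
      have "2 * C / a\<^sub>1 * g \<le> 2 * C / a\<^sub>1 * (2 * b)"
        using that pos by (intro mult_left_mono) auto
      moreover have "2 / a\<^sub>2 * ?\<delta> \<le> 2 / a\<^sub>2 * ((3 * C + 1) * b)"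
        using that pos by (intro mult_left_mono) auto
      moreover have "D * b = 2 * C / a\<^sub>1 * (2 * b) + 2 / a\<^sub>2 * ((3 * C + 1) * b)"
        by (simp add: D_def algebra_simps)
      ultimately show ?thesis by linarith
    qed
    have "C * (g + q) \<le> C * (3 * (s * \<epsilon>))" using g q pos by (intro mult_left_mono) auto
    then have dl: "?\<delta> \<le> (3 * C + 1) * (s * \<epsilon>)" using r by (simp add: distrib_right)
    also have "\<dots> = (3 * C + 1) * s * \<epsilon>" by simp
    also have "\<dots> \<le> 1 * \<epsilon>" using s1 e by (intro mult_right_mono) auto
    finally have 1: "?\<delta> \<le> \<epsilon>" by simp
    have "2 * C / a\<^sub>1 * g + 2 / a\<^sub>2 * ?\<delta> \<le> D * (s * \<epsilon>)"
      using g dl by (intro split) auto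
    also have "\<dots> \<le> D * (s * 1)" using D s e by (intro mult_left_mono) auto
    finally have 2: "2 * C / a\<^sub>1 * g + 2 / a\<^sub>2 * ?\<delta> \<le> a\<^sub>0" using s2 by simp
    have "C * (g + q) \<le> C * (3 * ?t)" using g q r p pos by (intro mult_left_mono) auto
    moreover have "(3 * C + 1) * ?t = C * (3 * ?t) + ?t" by (simp add: algebra_simps)
    ultimately have "?\<delta> \<le> (3 * C + 1) * ?t" using p q r by linarith
    then have 3: "2 * C / a\<^sub>1 * g + 2 / a\<^sub>2 * ?\<delta> \<le> D * ?t"
      using g q r p by (intro split) auto
    from 1 2 3 show "?\<delta> \<le> \<epsilon> \<and> 2 * C / a\<^sub>1 * g + 2 / a\<^sub>2 * ?\<delta> \<le> a\<^sub>0 \<and>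
        2 * C / a\<^sub>1 * g + 2 / a\<^sub>2 * ?\<delta> \<le> D * ?t" by blast
  qed
qed

lemma rescale_rate:
  assumes N: "0 < N" and K: "0 < K" and n: "real n = real N / real K"
  shows "(sqrt (real d / real K) + sqrt (u / real K) + real m / real K) / sqrt (real n)
    = sqrt (real d / real N) + sqrt (u / real N) + real m / sqrt (real N * real K)"
proof -
  have r: "sqrt (t / real K) / sqrt (real n) = sqrt (t / real N)" for t
    using N K by (simp add: n flip: real_sqrt_divide)
  have "real K * sqrt (real n) = sqrt ((real K)\<^sup>2 * real n)"
    by (simp add: real_sqrt_mult)
  also have "(real K)\<^sup>2 * real n = real N * real K"
    using K by (simp add: n power2_eq_square)
  finally have "real m / real K / sqrt (real n) = real m / sqrt (real N * real K)" by simp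
  then show ?thesis by (simp add: add_divide_distrib r)
qed

section \<open>Deviation of the minimiser\<close>

theorem theorem4:
  fixes C\<^sub>0 a\<^sub>0 a\<^sub>1 a\<^sub>2 :: real
  assumes "VC_constant C\<^sub>0"
    and "0 < a\<^sub>0" and "0 < a\<^sub>1" and "0 < a\<^sub>2"
  shows "\<exists>c\<^sub>0>0. \<exists>c\<^sub>1>0.
    \<forall>(N::nat) (d::nat) (K::nat) (B :: nat \<Rightarrow> nat set) (M :: 'a measure)
      (Xt :: nat \<Rightarrow> 'a \<Rightarrow> real vec) (X :: nat \<Rightarrow> 'a \<Rightarrow> real vec)
      (\<mu> :: real vec) (\<Sigma> :: real mat) (R :: real mat) (m::nat)
      (\<epsilon>::real) (\<phi>\<^sub>l::real) (\<phi>\<^sub>u::real).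
      1 \<le> N \<longrightarrow> 1 \<le> d \<longrightarrow> 1 \<le> K \<longrightarrow> K \<le> N \<longrightarrow> K dvd N \<longrightarrow>
      equal_blocks N K B \<longrightarrow>
      prob_space M \<longrightarrow>
      prob_space.indep_vars M (\<lambda>_. borel_vec d) Xt {..<N} \<longrightarrow>
      (\<forall>i<N. has_mean_cov M d (Xt i) \<mu> \<Sigma>) \<longrightarrow>
      invertible_mat \<Sigma> \<longrightarrow>
      is_inv_sqrt d \<Sigma> R \<longrightarrow>
      common_block_law M N d K B R \<mu> Xt \<longrightarrow>
      corrupted M N d m Xt X \<longrightarrow>
      0 < \<epsilon> \<longrightarrow> \<epsilon> < 1 / 8 \<longrightarrow> 0 < \<phi>\<^sub>l \<longrightarrow> \<phi>\<^sub>l < \<phi>\<^sub>u \<longrightarrow>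
      (let H = H_tail M N K R \<mu> Xt; W = W_quantile M N K R \<mu> Xt in
        (\<forall>v\<in>carrier_vec d. norm2 v = 1 \<longrightarrow>
           max (W v (1/4 - 2*\<epsilon>) - W v (1/2 + 2*\<epsilon>)) (W v (1/2 - 2*\<epsilon>) - W v (3/4 + 2*\<epsilon>)) \<le> \<phi>\<^sub>u) \<and>
        (\<forall>v\<in>carrier_vec d. norm2 v = 1 \<longrightarrow>
           min (W v (1/4 + 2*\<epsilon>) - W v (1/2 - 2*\<epsilon>)) (W v (1/2 + 2*\<epsilon>) - W v (3/4 - 2*\<epsilon>)) \<ge> \<phi>\<^sub>l) \<and>
        (\<forall>v\<in>carrier_vec d. norm2 v = 1 \<longrightarrow>
           (\<forall>r. (2 * C\<^sub>0 / a\<^sub>1) * sqrt ((real d + 1) / real K) \<le> r \<and> r \<le> a\<^sub>0 \<longrightarrow>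
              H v r \<le> 1/2 - a\<^sub>2 * r))) \<longrightarrow>
      real m \<le> c\<^sub>0 * \<epsilon> * real K \<longrightarrow>
      c\<^sub>0 * real K \<ge> real d / \<epsilon>\<^sup>2 \<longrightarrow>
      (\<forall>u. 0 < u \<and> u \<le> c\<^sub>0 * \<epsilon>\<^sup>2 * real K \<longrightarrow>
        (\<exists>E\<in>sets M. measure M E \<ge> 1 - 2 * exp (- u) \<and>
          (\<forall>\<omega>\<in>E. \<forall>\<mu>hat.
             is_arg_min (SDO d K B (\<lambda>i. X i \<omega>)) (\<lambda>\<nu>. \<nu> \<in> carrier_vec d) \<mu>hat \<longrightarrow>
             norm2 (R *\<^sub>v (\<mu>hat - \<mu>))
               \<le> (c\<^sub>1 * \<phi>\<^sub>u / \<phi>\<^sub>l) *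
                  (sqrt (real d / real N) + sqrt (u / real N) + real m / sqrt (real N * real K)))))"
proof -
  have C: "0 < C\<^sub>0" using assms(1) by (simp add: VC_constant_def)
  obtain s D :: real where s: "0 < s" and D: "0 < D"
    and rate: "\<And>\<epsilon> g p q r. 0 < \<epsilon> \<Longrightarrow> \<epsilon> \<le> 1 \<Longrightarrow> 0 \<le> g \<Longrightarrow> g \<le> 2 * p \<Longrightarrow> p \<le> s * \<epsilon> \<Longrightarrow> 0 \<le> q \<Longrightarrow>
       q \<le> s * \<epsilon> \<Longrightarrow> 0 \<le> r \<Longrightarrow> r \<le> s * \<epsilon> \<Longrightarrow>
       C\<^sub>0 * (g + q) + r \<le> \<epsilon> \<and>
       2 * C\<^sub>0 / a\<^sub>1 * g + 2 / a\<^sub>2 * (C\<^sub>0 * (g + q) + r) \<le> a\<^sub>0 \<and>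
       2 * C\<^sub>0 / a\<^sub>1 * g + 2 / a\<^sub>2 * (C\<^sub>0 * (g + q) + r) \<le> D * (p + q + r)"
    using rate_constants[OF C assms(2-4)] by blast
  show ?thesis
  \<comment> \<open>\<open>s\<^sup>2\<close> bounds \<open>d/K\<close> and \<open>u/K\<close>, which enter under a root; \<open>s\<close> bounds \<open>m/K\<close>, which does not.\<close>
  proof (rule exI[of _ "min (s\<^sup>2) s"], intro conjI exI[of _ "2 * D"] allI impI, goal_cases)
    case 1 then show ?case using s by simp
  next
    case 2 then show ?case using D by simp
  next
    case (3 N d K B M Xt X \<mu> \<Sigma> R m \<epsilon> \<phi>\<^sub>l \<phi>\<^sub>u u)
    note N = 3(1) and d = 3(2) and K = 3(3) and dvd = 3(5) and B = 3(6) and ind = 3(8)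
      and mc = 3(9) and R = 3(11) and law = 3(12) and corr = 3(13) and eps = 3(14,15)
      and phi = 3(16,17) and m = 3(19) and Kd = 3(20) and u = 3(21)
    interpret prob_space M by (rule 3(7))
    let ?H = "H_tail M N K R \<mu> Xt" and ?W = "W_quantile M N K R \<mu> Xt"
    have hyp: "?W v (1/4 - 2*\<epsilon>) - ?W v (1/2 + 2*\<epsilon>) \<le> \<phi>\<^sub>u" "?W v (1/2 - 2*\<epsilon>) - ?W v (3/4 + 2*\<epsilon>) \<le> \<phi>\<^sub>u"
        "\<phi>\<^sub>l \<le> ?W v (1/4 + 2*\<epsilon>) - ?W v (1/2 - 2*\<epsilon>)" "\<phi>\<^sub>l \<le> ?W v (1/2 + 2*\<epsilon>) - ?W v (3/4 - 2*\<epsilon>)"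
        "\<And>r. (2 * C\<^sub>0 / a\<^sub>1) * sqrt ((real d + 1) / real K) \<le> r \<Longrightarrow> r \<le> a\<^sub>0 \<Longrightarrow> ?H v r \<le> 1/2 - a\<^sub>2 * r"
      if "v \<in> carrier_vec d" "norm2 v = 1" for v
      using 3(18) that by (simp_all add: Let_def)
    have Rc: "R \<in> carrier_mat d d" using R by (simp add: is_inv_sqrt_def)
    have Xm: "Xt i \<in> M \<rightarrow>\<^sub>M borel_vec d" if "i < N" for i
      using mc that by (simp add: has_mean_cov_def)
    have mu: "\<mu> \<in> carrier_vec d" and Sig: "\<Sigma> \<in> carrier_mat d d"
      using mc N by (auto simp: has_mean_cov_def)
    have K0: "0 < real K" using K by simp
    define g where "g = sqrt (real (d + 1) / real K)"
    define p where "p = sqrt (real d / real K)"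
    define q where "q = sqrt (u / real K)"
    define \<delta> where "\<delta> = C\<^sub>0 * (g + q) + real m / real K"
    define \<rho> where "\<rho> = 2 * C\<^sub>0 / a\<^sub>1 * g + 2 / a\<^sub>2 * \<delta>"
    have c0: "min (s\<^sup>2) s * t \<le> s\<^sup>2 * t" "min (s\<^sup>2) s * t \<le> s * t" if "0 \<le> t" for t
      using that by (auto intro!: mult_right_mono)
    have sq: "sqrt (t / real K) \<le> s * \<epsilon>" if t: "t \<le> s\<^sup>2 * (\<epsilon>\<^sup>2 * real K)" for t
    proof -
      have "t / real K \<le> (s * \<epsilon>)\<^sup>2"
        using t K0 by (simp add: divide_le_eq power_mult_distrib mult.assoc)
      then show ?thesis using s eps by (intro real_le_lsqrt) auto
    qed
    have "real d \<le> min (s\<^sup>2) s * real K * \<epsilon>\<^sup>2" using Kd eps by (simp add: divide_le_eq)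
    then have p: "p \<le> s * \<epsilon>"
      unfolding p_def using c0(1)[of "\<epsilon>\<^sup>2 * real K"] by (intro sq) (simp add: mult_ac)
    have q: "q \<le> s * \<epsilon>" "0 \<le> q"
    proof -
      have "u \<le> s\<^sup>2 * (\<epsilon>\<^sup>2 * real K)"
        using c0(1)[of "\<epsilon>\<^sup>2 * real K"] u by (simp add: mult_ac)
      then show "q \<le> s * \<epsilon>" unfolding q_def by (rule sq)
      show "0 \<le> q" using u by (simp add: q_def)
    qed
    have "0 \<le> \<epsilon> * real K" using eps K0 by simp
    from c0(2)[OF this] m have "real m \<le> s * (\<epsilon> * real K)" by (simp only: mult.assoc)
    then have r: "real m / real K \<le> s * \<epsilon>" "0 \<le> real m / real K"
      using K0 by (auto simp: divide_le_eq mult_ac)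
    have "g \<le> sqrt (2\<^sup>2 * (real d / real K))"
      unfolding g_def using d K0 by (intro real_sqrt_le_mono) (simp add: divide_right_mono)
    also have "\<dots> = \<bar>2\<bar> * p" unfolding p_def by (simp only: real_sqrt_mult real_sqrt_abs)
    finally have g: "g \<le> 2 * p" "0 < g"
      using K0 by (simp_all add: g_def)
    have \<delta>: "\<delta> \<le> \<epsilon>" and \<rho>: "\<rho> \<le> a\<^sub>0" "\<rho> \<le> D * (p + q + real m / real K)"
      using rate[of \<epsilon> g p q "real m / real K"] eps g p q r unfolding \<rho>_def \<delta>_def by auto
    have \<delta>0: "0 < \<delta>" unfolding \<delta>_def using C g q r by (intro add_pos_nonneg mult_pos_pos) auto
    have \<rho>g: "2 * C\<^sub>0 / a\<^sub>1 * g \<le> \<rho>" using \<delta>0 assms(4) by (simp add: \<rho>_def)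
    have \<rho>0: "0 \<le> \<rho>"
      by (rule order_trans[OF _ \<rho>g]) (use C g(2) assms(3) in auto)
    have "a\<^sub>2 * (2 / a\<^sub>2 * \<delta>) \<le> a\<^sub>2 * \<rho>"
      using C g assms(3,4) by (intro mult_left_mono) (auto simp: \<rho>_def)
    \<comment> \<open>The summand \<open>(2/a\<^sub>2) \<delta>\<close> of \<open>\<rho>\<close> is twice what offsets \<open>\<delta>\<close>.\<close>
    then have a\<rho>: "\<delta> < a\<^sub>2 * \<rho>" using \<delta>0 assms(4) by simp
    have H\<rho>: "?H v \<rho> + \<delta> < 1/2" if "v \<in> carrier_vec d" "norm2 v = 1" for v
      using hyp(5)[OF that, of \<rho>] \<rho>g \<rho>(1) a\<rho> by (simp add: g_def add.commute)
    obtain E where E: "E \<in> events" "1 - exp (- u) \<le> prob E"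
      and emp: "\<And>\<omega> v. \<omega> \<in> E \<Longrightarrow> v \<in> carrier_vec d \<Longrightarrow> norm2 v = 1 \<Longrightarrow>
         empirical_tail K (\<lambda>k. std_sum d R \<mu> (B k) (\<lambda>i. X i \<omega>) \<bullet> v) (?H v) \<delta>"
      using corrupted_empirical_tail[OF assms(1) d K B ind Rc mu law corr, of u] u
      unfolding \<delta>_def g_def q_def by blast
    show ?case
    proof (intro bexI[of _ E] conjI ballI allI impI E(1))
      show "1 - 2 * exp (- u) \<le> prob E" using E(2) exp_gt_zero[of "- u"] by linarith
      fix \<omega> \<nu>
      assume om: "\<omega> \<in> E" and am: "is_arg_min (SDO d K B (\<lambda>i. X i \<omega>)) (\<lambda>\<nu>. \<nu> \<in> carrier_vec d) \<nu>"
      have omS: "\<omega> \<in> space M" using om sets.sets_into_space[OF E(1)] by blast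
      have size: "real (N div K) = real N / real K" using dvd by (rule real_of_nat_div)
      interpret standardisation d "N div K" B K \<Sigma> R \<mu> "\<lambda>i. X i \<omega>"
      proof
        show "0 < N div K" using dvd N K by (auto elim!: dvdE)
        show "card (B k) = N div K" if "k < K" for k using B that by (simp add: equal_blocks_def)
        show "X i \<omega> \<in> carrier_vec d" if "k < K" "i \<in> B k" for k i
        proof -
          have "i < N" using B that by (auto simp: equal_blocks_def)
          then show ?thesis using corr omS by (simp add: corrupted_def)
        qed
      qed (use R Sig mu K in auto)
      have "sqrt (real (N div K)) * norm2 (R *\<^sub>v (\<nu> - \<mu>)) \<le> 2 * (\<rho> * (\<phi>\<^sub>u / \<phi>\<^sub>l))"
      proof (rule SDO_argmin_bound[OF _ _ _ _ _ \<rho>0 am])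
        fix e assume e: "e \<in> carrier_vec d" "norm2 e = 1"
        interpret emp: empirical_tail K "proj e" "?H e" \<delta> by (rule emp[OF om e])
        have ne: "- e \<in> carrier_vec d" "norm2 (- e) = 1"
          using e by (simp_all add: norm2_def)
        \<comment> \<open>Applied to \<open>- e\<close>, the same event controls the reflected sample.\<close>
        interpret neg: empirical_tail K "proj (- e)" "?H (- e)" \<delta> by (rule emp[OF om ne])
        have projn: "proj (- e) k = - proj e k" for k
          using e(1) by simp
        show "\<bar>Med K (proj e)\<bar> \<le> \<rho>"
          using neg.count_ge by (intro emp.abs_Med_le[of \<rho> "?H (- e)", OF H\<rho>[OF e] _ H\<rho>[OF ne]]) (simp add: projn)
        have le: "t \<le> ?H e (?W e t)" if "0 < t" "t < 1" for t
          by (rule W_quantile_bounds(1)[where N = N and Y = Xt, OF Xm Rc mu e(1) that])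
        have gt: "?H e r < t" if "0 < t" "t < 1" "?W e t < r" for t r
          by (rule W_quantile_bounds(2)[where N = N and Y = Xt, OF Xm Rc mu e(1) that])
        have "\<delta> < 2 * \<epsilon>" using \<delta> eps by simp
        note qb = emp.quantile_bounds[of "?W e" \<epsilon> \<phi>\<^sub>u \<phi>\<^sub>l, OF le gt eps this hyp(1-4)[OF e] phi(1)]
        show "\<phi>\<^sub>l \<le> MAD e" by (rule qb(1))
        show "MAD e \<le> \<phi>\<^sub>u" by (rule qb(2))
      qed (use phi in auto)
      moreover have "0 < sqrt (real (N div K))" using n by simp
      ultimately have "norm2 (R *\<^sub>v (\<nu> - \<mu>)) \<le> 2 * (\<rho> * (\<phi>\<^sub>u / \<phi>\<^sub>l)) / sqrt (real (N div K))"
        by (simp only: pos_le_divide_eq mult.commute)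
      also have "\<dots> \<le> 2 * (D * (p + q + real m / real K) * (\<phi>\<^sub>u / \<phi>\<^sub>l)) / sqrt (real (N div K))"
        using \<rho>(2) phi by (intro divide_right_mono mult_left_mono mult_right_mono) auto
      also have "\<dots> = (2 * D * \<phi>\<^sub>u / \<phi>\<^sub>l) * ((p + q + real m / real K) / sqrt (real (N div K)))"
        by simp
      also have "(p + q + real m / real K) / sqrt (real (N div K))
          = sqrt (real d / real N) + sqrt (u / real N) + real m / sqrt (real N * real K)"
        unfolding p_def q_def using N K by (intro rescale_rate size) auto
      finally show "norm2 (R *\<^sub>v (\<nu> - \<mu>)) \<le> (2 * D * \<phi>\<^sub>u / \<phi>\<^sub>l) *
          (sqrt (real d / real N) + sqrt (u / real N) + real m / sqrt (real N * real K))" .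
    qed
  qed
qed

end
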